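(* For every $0<\delta<1$ there exists a constant $c(\delta)$, with $a\log(2/\delta)\le c(\delta)\le b\log(2/\delta)$ for some absolute constants $0<a\le b$, for which the following holds. Let $F$ be an $L$-subgaussian class of functions on a probability space $(\Omega,\mu)$ and assume that for some $\alpha\in\mathbb{R}$, $\mathbb{E}f=\alpha$ for every $f\in F$. Let $X_1,\dots,X_k$ be independent and distributed according to $\mu$. Then, with probability at least $1-\delta$, for every nonempty $I\subset\{1,\dots,k\}$ and every integer $s\ge 0$ that satisfies $2^s\le|I|\log(ek/|I|)$, $$\gamma_{2,s+1}(F,L_2^I)\le c(\delta)\,L\,\gamma_{2,s}(F,L_2)\sqrt{\log(ek/|I|)}.$$
   Context: $\|f\|_{\psi_2}=\inf\{C>0:\mathbb{E}\exp(|f|^2/C^2)\le2\}$. A set $F\subset L_2(\mu)$ is $L$-subgaussian if $\|f\|_{\psi_2}\le L\|f\|_{L_2}$ and $\|f-g\|_{\psi_2}\le L\|f-g\|_{L_2}$ for every $f,g\in F$; $L_2=L_2(\mu)$. For $I\subset\{1,\dots,k\}$, $\|f\|_{L_2^I}=(|I|^{-1}\sum_{i\in I}f^2(X_i))^{1/2}$. For a (semi-)metric space $(T,d)$, an admissible sequence is a sequence $(T_s)_{s\ge0}$ of subsets of $T$ with $|T_0|=1$ and $|T_s|\le2^{2^s}$ for $s\ge1$; for an integer $s_0\ge0$, $\gamma_{2,s_0}(T,d)=\inf\sup_{t\in T}\sum_{s=s_0}^\infty2^{s/2}d(t,T_s)$, the infimum being over all admissible sequences. $\gamma_{2,s}(F,E)$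 for a normed space $E$ refers to the metric induced by the norm of $E$.
   Formalization: F is assumed separable (off one null set, each f in F is a pointwise limit of a sequence from a fixed countable subset); without it the claim fails, e.g. for 0 and all singleton indicators on [0,1]. Also L>0, and the constants are stated per choice of underlying sets for the spaces. *)

theory Defs
  imports "HOL-Probability.Probability"
begin

text \<open>The infimum over the empty set is \<open>\<infinity>\<close>.\<close>

definition psi2_norm :: "'a measure \<Rightarrow> ('a \<Rightarrow> real) \<Rightarrow> ennreal" where
  "psi2_norm M f =
     (INF C\<in>{C::real. 0 < C \<and> (\<integral>\<^sup>+x. ennreal (exp (\<bar>f x\<bar>\<^sup>2 / C\<^sup>2)) \<partial>M) \<le> 2}. ennreal C)"

definition L2_space :: "'a measure \<Rightarrow> ('a \<Rightarrow> real) set" where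
  "L2_space M = {f \<in> borel_measurable M. integrable M (\<lambda>x. (f x)\<^sup>2)}"

text \<open>Meaningful only on \<^const>\<open>L2_space\<close>.\<close>

definition L2_norm :: "'a measure \<Rightarrow> ('a \<Rightarrow> real) \<Rightarrow> real" where
  "L2_norm M f = sqrt (\<integral>x. (f x)\<^sup>2 \<partial>M)"

definition subgaussian_class :: "'a measure \<Rightarrow> real \<Rightarrow> ('a \<Rightarrow> real) set \<Rightarrow> bool" where
  "subgaussian_class M L F \<longleftrightarrow>
     F \<subseteq> L2_space M \<and>
     (\<forall>f\<in>F. psi2_norm M f \<le> ennreal (L * L2_norm M f)) \<and>
     (\<forall>f\<in>F. \<forall>g\<in>F. psi2_norm M (\<lambda>x. f x - g x) \<le> ennreal (L * L2_norm M (\<lambda>x. f x - g x)))"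

text \<open>
  Separability of the process \<open>f \<mapsto> f(X)\<close>.  Elements of \<open>L\<^sub>2(\<mu>)\<close> are only given up to null sets,
  whereas the empirical seminorms evaluate all members of an arbitrary class at the sample points.
  Without fixing suitable versions, statements about empirical seminorms are
  false in general (consider the indicators of all singletons under Lebesgue measure on the unit
  interval).  Every countable class is separable in this sense.  The null set \<open>Z\<close> is the same
  for all members of the class.
\<close>

definition separable_class :: "'a measure \<Rightarrow> ('a \<Rightarrow> real) set \<Rightarrow> bool" where
  "separable_class M F \<longleftrightarrow>
     (\<exists>F0 Z. F0 \<subseteq> F \<and> countable F0 \<and> Z \<in> null_sets M \<and>
        (\<forall>f\<in>F. \<exists>g. (\<forall>n::nat. g n \<in> F0) \<and>
           (\<forall>x\<in>space M - Z. (\<lambda>n. g n x) \<longlonglongrightarrow> f x)))"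

definition emp_norm :: "(nat \<Rightarrow> 'a) \<Rightarrow> nat set \<Rightarrow> ('a \<Rightarrow> real) \<Rightarrow> real" where
  "emp_norm x I f = sqrt ((\<Sum>i\<in>I. (f (x i))\<^sup>2) / real (card I))"

definition admissible_seq :: "'t set \<Rightarrow> (nat \<Rightarrow> 't set) \<Rightarrow> bool" where
  "admissible_seq T A \<longleftrightarrow>
     (\<forall>s. A s \<subseteq> T) \<and> card (A 0) = 1 \<and>
     (\<forall>s\<ge>1. finite (A s) \<and> card (A s) \<le> 2 ^ (2 ^ s))"

definition set_dist :: "('t \<Rightarrow> 't \<Rightarrow> real) \<Rightarrow> 't \<Rightarrow> 't set \<Rightarrow> ennreal" where
  "set_dist d t S = (INF u\<in>S. ennreal (d t u))"

text \<open>
  The series runs over \<open>s \<ge> s\<^sub>0\<close>; it is reindexed by \<open>s = j + s\<^sub>0\<close>.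
\<close>

definition gamma2 :: "nat \<Rightarrow> 't set \<Rightarrow> ('t \<Rightarrow> 't \<Rightarrow> real) \<Rightarrow> ennreal" where
  "gamma2 s0 T d =
     (INF A\<in>{A. admissible_seq T A}. SUP t\<in>T.
        \<Sum>j. ennreal (2 powr (real (j + s0) / 2)) * set_dist d t (A (j + s0)))"

definition gamma2_norm :: "nat \<Rightarrow> ('a \<Rightarrow> real) set \<Rightarrow> (('a \<Rightarrow> real) \<Rightarrow> real) \<Rightarrow> ennreal" where
  "gamma2_norm s0 F N = gamma2 s0 F (\<lambda>f g. N (\<lambda>x. f x - g x))"

end

theory Submission
  imports Defs
begin

text \<open>Fix a sample, a set \<open>I\<close> of \<open>m\<close> indices and \<open>l = log (e k / m)\<close>, and let \<open>A\<close> be a nearly optimal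
  admissible sequence for \<open>\<gamma>\<^bsub>2,s\<^esub>(F, L\<^sub>2)\<close>.  The natural idea is to use \<open>A\<close> for the empirical norm as
  well.  For an increment \<open>h = f - g\<close> the sum of \<open>h\<^sup>2(X\<^sub>i)\<close> over \<open>I\<close> has an exponential moment, so it is
  at most of order \<open>L\<^sup>2 \<parallel>h\<parallel>\<^sup>2 (m + v)\<close> outside an event of probability \<open>exp (-v)\<close>
  (\<open>subgaussian_deviation\<close>).  There are at most \<open>exp (m l)\<close> sets \<open>I\<close> of size \<open>m\<close> and at most
  \<open>2\<^bsup>3 2^j\<^esup>\<close> pairs in \<open>A (j + 1) \<times> A j\<close>; with \<open>v = w (2\<^sup>j + m l)\<close> and \<open>w = 4 + ln (2 / \<delta>)\<close> a union
  bound controls all increments of all links of the chain at once (\<open>uniform_increment_bound\<close>).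

  As long as \<open>2\<^sup>j \<le> m l\<close>, the empirical norm of a link is therefore at most a constant times
  \<open>L \<surd>w \<surd>l\<close> times its \<open>L\<^sub>2\<close> norm, which is exactly the loss that the theorem allows.  Beyond the level
  \<open>u\<close> with \<open>2\<^sup>u \<approx> m l\<close> this fails: a link costs the additional factor \<open>(2\<^sup>j / (m l))\<^bsup>1/2\<^esup>\<close>.  This is
  still good enough to sum the links without the weights \<open>2\<^bsup>j/2\<^esup>\<close>, so that \<open>A u\<close> is an \<open>R\<close>-net of \<open>F\<close>
  for the empirical norm, where \<open>2\<^bsup>u/2\<^esup> R\<close> is of the order of the right-hand side of the theorem
  (\<open>weighted_increment_le\<close> and \<open>chain_sum_le\<close> treat both ranges together, by means of the weights
  \<open>2\<^bsup>min(j,u)/2\<^esup>\<close>).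

  Above level \<open>u\<close> the sequence \<open>A\<close> is replaced.  The empirical norm sees only \<open>m \<le> 2\<^sup>u\<close> coordinates,
  so a ball of radius \<open>R\<close> is covered by \<open>(C 2\<^sup>i)\<^sup>m\<close> sets of radius \<open>2\<^sup>-\<^sup>i R\<close>
  (\<open>emp_norm_ball_cover\<close>), and this is at most \<open>2\<^bsup>2^(u+i+O(1))\<^esup>\<close>.  With these nets the remaining levels
  contribute a geometric series, of order \<open>2\<^bsup>u/2\<^esup> R\<close> (\<open>gamma2_emp_norm_le\<close>).

  Two limits remain.  A function is the limit of its chain only almost surely; this is used for the
  countably many functions that separability provides, and the bound extends to \<open>F\<close> by density for
  the empirical norm.  The infimum in \<open>\<gamma>\<^sub>2\<close> need not be attained; the argument is run for sequences
  that are optimal up to \<open>1 / (n + 1)\<close>, and the event of the theorem is the event that the bounds hold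
  for infinitely many \<open>n\<close>, whose probability is still at least \<open>1 - \<delta>\<close>.\<close>

section \<open>Covering balls of the empirical seminorm\<close>

text \<open>The bound grows only linearly in \<open>t\<close>: with \<open>q = exp (-1/t)\<close> the two-sided geometric series is
  \<open>1 + 2 q / (1 - q)\<close>, and \<open>q / (1 - q) \<le> t\<close>.\<close>

lemma sum_exp_abs_le:
  fixes t :: real
  assumes "t > 0"
  shows "(\<Sum>z\<in>{- int B..int B}. exp (- \<bar>real_of_int z\<bar> / t)) \<le> 1 + 2 * t"
proof -
  define q where "q = exp (- 1 / t)"
  have q0: "q > 0"
    by (simp add: q_def)
  have "1 + 1 / t \<le> exp (1 / t)"
    by (rule exp_ge_add_one_self)
  moreover have "q * exp (1 / t) = 1"
    by (simp add: q_def flip: exp_add)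
  ultimately have "q * (1 + 1 / t) \<le> 1"
    using q0 by (metis mult_left_mono less_imp_le)
  then have q: "q \<le> t * (1 - q)"
    using assms by (simp add: field_simps)
  have pow: "exp (- \<bar>real_of_int z\<bar> / t) = q ^ nat \<bar>z\<bar>" for z
    by (simp add: q_def flip: exp_of_nat_mult)
  have "(\<Sum>z\<in>{- int B..int B}. q ^ nat \<bar>z\<bar>) \<le> 1 + 2 * t * (1 - q ^ B)"
  proof (induction B)
    case (Suc B)
    have *: "{- int (Suc B)..int (Suc B)} =
        insert (- int (Suc B)) (insert (int (Suc B)) {- int B..int B})"
      by auto
    have "(\<Sum>z\<in>{- int (Suc B)..int (Suc B)}. q ^ nat \<bar>z\<bar>) =
        2 * q ^ Suc B + (\<Sum>z\<in>{- int B..int B}. q ^ nat \<bar>z\<bar>)"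
      unfolding * by (subst sum.insert; simp add: nat_add_distrib)+
    also have "\<dots> \<le> 2 * q ^ B * q + (1 + 2 * t * (1 - q ^ B))"
      using Suc by simp
    also have "\<dots> \<le> 2 * q ^ B * (t * (1 - q)) + (1 + 2 * t * (1 - q ^ B))"
      using q q0 by (intro add_right_mono mult_left_mono) auto
    also have "\<dots> = 1 + 2 * t * (1 - q ^ Suc B)"
      by (simp add: algebra_simps)
    finally show ?case .
  qed simp
  also have "\<dots> \<le> 1 + 2 * t * 1"
    using assms q0 by (intro add_left_mono mult_left_mono) auto
  finally show ?thesis
    by (simp only: pow mult_1_right)
qed

text \<open>An exponential Markov inequality for counting measure: a point of the ball has weight
  \<open>exp (m - \<Sum>\<bar>z\<^sub>i\<bar> / t) \<ge> 1\<close>, and the total weight of a box factorizes.  With the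
  weights decaying at the scale \<open>t\<close>, the count is polynomial in \<open>t\<close> for a fixed dimension; this is
  what makes the nets at high levels small enough.\<close>

lemma card_integer_points_l1_ball:
  fixes t :: real
  assumes "finite I" and t: "t > 0"
  defines "S \<equiv> {z \<in> I \<rightarrow>\<^sub>E (UNIV :: int set). (\<Sum>i\<in>I. \<bar>real_of_int (z i)\<bar>) \<le> real (card I) * t}"
  shows "finite S" and "real (card S) \<le> (exp 1 * (1 + 2 * t)) ^ card I"
proof -
  define B where "B = nat \<lceil>real (card I) * t\<rceil>"
  define P where "P = (\<Pi>\<^sub>E i\<in>I. {- int B..int B})"
  have "S \<subseteq> P"
  proof
    fix z assume z: "z \<in> S"
    have "z i \<in> {- int B..int B}" if "i \<in> I" for i
    proof -
      have "\<bar>real_of_int (z i)\<bar> \<le> (\<Sum>i\<in>I. \<bar>real_of_int (z i)\<bar>)"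
        using assms(1) that by (intro member_le_sum) auto
      also have "\<dots> \<le> real (card I) * t"
        using z by (simp add: S_def)
      finally have "\<bar>real_of_int (z i)\<bar> \<le> real_of_int \<lceil>real (card I) * t\<rceil>"
        by linarith
      moreover have "\<lceil>real (card I) * t\<rceil> \<ge> 0"
        using t by (simp add: le_ceiling_iff) (smt (verit) mult_nonneg_nonneg of_nat_0_le_iff)
      ultimately show ?thesis
        by (simp add: B_def) linarith
    qed
    then show "z \<in> P"
      using z by (auto simp: P_def S_def PiE_iff)
  qed
  have "finite P"
    unfolding P_def using assms(1) by (intro finite_PiE) auto
  with \<open>S \<subseteq> P\<close> show "finite S"
    by (rule finite_subset)
  have "real (card S) = (\<Sum>z\<in>S. 1)"
    by simp
  also have "\<dots> \<le> (\<Sum>z\<in>S. exp (real (card I) - (\<Sum>i\<in>I. \<bar>real_of_int (z i)\<bar>) / t))"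
    using t by (intro sum_mono) (auto simp: S_def field_simps)
  also have "\<dots> \<le> (\<Sum>z\<in>P. exp (real (card I) - (\<Sum>i\<in>I. \<bar>real_of_int (z i)\<bar>) / t))"
    using \<open>finite P\<close> \<open>S \<subseteq> P\<close> by (intro sum_mono2) auto
  also have "\<dots> = exp 1 ^ card I * (\<Sum>z\<in>P. \<Prod>i\<in>I. exp (- \<bar>real_of_int (z i)\<bar> / t))"
  proof -
    have "exp (real (card I) - (\<Sum>i\<in>I. \<bar>real_of_int (z i)\<bar>) / t) =
        exp 1 ^ card I * (\<Prod>i\<in>I. exp (- \<bar>real_of_int (z i)\<bar> / t))" for z
      using assms(1)
      by (simp add: sum_divide_distrib sum_negf flip: exp_of_nat_mult exp_sum exp_add)
    then show ?thesis
      by (simp add: sum_distrib_left)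
  qed
  also have "(\<Sum>z\<in>P. \<Prod>i\<in>I. exp (- \<bar>real_of_int (z i)\<bar> / t)) =
      (\<Prod>i\<in>I. \<Sum>y\<in>{- int B..int B}. exp (- \<bar>real_of_int y\<bar> / t))"
    unfolding P_def by (rule prod_sum_PiE [symmetric]) (use assms in auto)
  also have "\<dots> \<le> (\<Prod>i\<in>I. 1 + 2 * t)"
    by (intro prod_mono conjI sum_nonneg sum_exp_abs_le t) auto
  finally show "real (card S) \<le> (exp 1 * (1 + 2 * t)) ^ card I"
    by (simp add: power_mult_distrib)
qed

lemma emp_norm_nonneg [simp]: "0 \<le> emp_norm x I f"
  by (simp add: emp_norm_def sum_nonneg)

lemma emp_norm_triangle:
  "emp_norm x I (\<lambda>y. f y - h y) \<le> emp_norm x I (\<lambda>y. f y - g y) + emp_norm x I (\<lambda>y. g y - h y)"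
proof -
  have eq: "emp_norm x I f = L2_set (\<lambda>i. f (x i)) I / sqrt (real (card I))" for f
    by (simp add: emp_norm_def L2_set_def real_sqrt_divide)
  have "L2_set (\<lambda>i. f (x i) - h (x i)) I
      \<le> L2_set (\<lambda>i. f (x i) - g (x i)) I + L2_set (\<lambda>i. g (x i) - h (x i)) I"
    using L2_set_triangle_ineq[of "\<lambda>i. f (x i) - g (x i)" "\<lambda>i. g (x i) - h (x i)" I] by simp
  then show ?thesis
    by (simp add: eq divide_right_mono flip: add_divide_distrib)
qed

text \<open>Cauchy-Schwarz against the constant \<open>1\<close>, in the form \<open>2 R \<bar>h\<bar> \<le> h\<^sup>2 + R\<^sup>2\<close>.\<close>

lemma sum_abs_le_emp_norm:
  assumes "finite I" and le: "emp_norm x I h \<le> R" and R: "R > 0"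
  shows "(\<Sum>i\<in>I. \<bar>h (x i)\<bar>) \<le> real (card I) * R"
proof (cases "I = {}")
  case False
  have "(\<Sum>i\<in>I. (h (x i))\<^sup>2) / real (card I) \<le> R\<^sup>2"
    using le R unfolding emp_norm_def by (simp add: real_sqrt_le_iff' sqrt_le_D)
  then have sq: "(\<Sum>i\<in>I. (h (x i))\<^sup>2) \<le> R\<^sup>2 * real (card I)"
    using False assms(1) by (simp add: field_simps card_gt_0_iff)
  have "2 * R * (\<Sum>i\<in>I. \<bar>h (x i)\<bar>) \<le> (\<Sum>i\<in>I. (h (x i))\<^sup>2 + R\<^sup>2)"
    unfolding sum_distrib_left
  proof (rule sum_mono)
    fix i
    show "2 * R * \<bar>h (x i)\<bar> \<le> (h (x i))\<^sup>2 + R\<^sup>2"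
      using sum_squares_bound[of R "\<bar>h (x i)\<bar>"] by simp
  qed
  also have "\<dots> \<le> 2 * R * (real (card I) * R)"
    using sq by (simp add: sum.distrib power2_eq_square algebra_simps)
  finally show ?thesis
    using R by simp
qed simp

lemma emp_norm_le_bound:
  assumes "finite I" and "\<And>i. i \<in> I \<Longrightarrow> \<bar>h (x i)\<bar> \<le> r" and "r \<ge> 0"
  shows "emp_norm x I h \<le> r"
proof (cases "I = {}")
  case False
  have "(\<Sum>i\<in>I. (h (x i))\<^sup>2) \<le> (\<Sum>i\<in>I. r\<^sup>2)"
    using assms by (intro sum_mono) (metis abs_ge_zero power2_abs power_mono)
  then have "(\<Sum>i\<in>I. (h (x i))\<^sup>2) / real (card I) \<le> r\<^sup>2"
    using False assms(1) by (simp add: field_simps card_gt_0_iff)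
  then show ?thesis
    using assms(3) unfolding emp_norm_def by (simp add: real_le_lsqrt)
qed (use assms in \<open>simp add: emp_norm_def\<close>)

text \<open>The seminorm depends only on the values at the points \<open>x\<^sub>i\<close>, so a volumetric estimate in dimension
  \<open>card I\<close> applies.  Rounding the vector of values to multiples of \<open>r\<close> yields cells of diameter at
  most \<open>r\<close>, even in the maximum norm; the cells that meet the ball are counted by their integer
  labels, which lie in an \<open>l\<^sub>1\<close> ball.  The centers are selected from \<open>S\<close> itself because the sets in an
  admissible sequence must consist of members of the class.\<close>

lemma emp_norm_ball_cover:
  assumes I: "finite I" and r: "r > 0" and R: "R > 0"
    and ball: "\<And>f. f \<in> S \<Longrightarrow> emp_norm x I (\<lambda>y. f y - g y) \<le> R"
  shows "\<exists>C\<subseteq>S. finite C \<and> real (card C) \<le> (exp 1 * (3 + 2 * (R / r))) ^ card I \<and>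
      (\<forall>f\<in>S. \<exists>h\<in>C. emp_norm x I (\<lambda>y. f y - h y) \<le> r)"
proof -
  define cell where "cell f = (\<lambda>i\<in>I. \<lfloor>(f (x i) - g (x i)) / r\<rfloor>)" for f
  define Z where
    "Z = {z \<in> I \<rightarrow>\<^sub>E (UNIV :: int set). (\<Sum>i\<in>I. \<bar>real_of_int (z i)\<bar>) \<le> real (card I) * (R / r + 1)}"
  have t: "R / r + 1 > 0"
    using r R by (simp add: add_pos_pos)
  have sub: "cell ` S \<subseteq> Z"
  proof
    fix z assume "z \<in> cell ` S"
    then obtain f where f: "f \<in> S" "z = cell f"
      by blast
    have "(\<Sum>i\<in>I. \<bar>real_of_int (z i)\<bar>) \<le> (\<Sum>i\<in>I. \<bar>f (x i) - g (x i)\<bar> / r + 1)"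
    proof (rule sum_mono)
      fix i assume "i \<in> I"
      have "\<bar>real_of_int \<lfloor>(f (x i) - g (x i)) / r\<rfloor>\<bar> \<le> \<bar>(f (x i) - g (x i)) / r\<bar> + 1"
        by linarith
      then show "\<bar>real_of_int (z i)\<bar> \<le> \<bar>f (x i) - g (x i)\<bar> / r + 1"
        using \<open>i \<in> I\<close> r by (simp add: f cell_def)
    qed
    also have "\<dots> = (\<Sum>i\<in>I. \<bar>f (x i) - g (x i)\<bar>) / r + real (card I)"
      by (simp add: sum.distrib sum_divide_distrib)
    also have "\<dots> \<le> real (card I) * R / r + real (card I)"
      using sum_abs_le_emp_norm[OF I ball[OF f(1)] R] r by (simp add: divide_right_mono)
    finally show "z \<in> Z"
      by (auto simp: Z_def f cell_def algebra_simps)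
  qed
  \<comment> \<open>one representative of each nonempty cell\<close>
  define C where "C = inv_into S cell ` cell ` S"
  have fin: "finite (cell ` S)" and card: "card (cell ` S) \<le> card Z"
    using card_integer_points_l1_ball(1)[OF I t] sub
    by (auto simp: Z_def intro: finite_subset card_mono)
  have "C \<subseteq> S"
    by (auto simp: C_def inv_into_into)
  moreover have "finite C"
    using fin by (simp add: C_def)
  moreover have "real (card C) \<le> (exp 1 * (3 + 2 * (R / r))) ^ card I"
  proof -
    have "card C \<le> card Z"
      using card_image_le[OF fin] card unfolding C_def by (meson le_trans)
    then have "real (card C) \<le> real (card Z)"
      by simp
    also have "\<dots> \<le> (exp 1 * (1 + 2 * (R / r + 1))) ^ card I"
      unfolding Z_def by (rule card_integer_points_l1_ball(2)[OF I t])
    finally show ?thesis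
      by (simp add: algebra_simps)
  qed
  moreover have "\<forall>f\<in>S. \<exists>h\<in>C. emp_norm x I (\<lambda>y. f y - h y) \<le> r"
  proof
    fix f assume f: "f \<in> S"
    define h where "h = inv_into S cell (cell f)"
    have "h \<in> C"
      using f by (metis C_def h_def imageI)
    have eq: "cell h = cell f"
      unfolding h_def using f by (intro f_inv_into_f[of "cell f" cell S]) auto
    have "emp_norm x I (\<lambda>y. f y - h y) \<le> r"
    proof (rule emp_norm_le_bound[OF I])
      fix i assume "i \<in> I"
      then have "\<lfloor>(h (x i) - g (x i)) / r\<rfloor> = \<lfloor>(f (x i) - g (x i)) / r\<rfloor>"
        using fun_cong[OF eq, of i] by (simp add: cell_def)
      then have "\<bar>(f (x i) - g (x i)) / r - (h (x i) - g (x i)) / r\<bar> \<le> 1"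
        by linarith
      then have "\<bar>(f (x i) - h (x i)) / r\<bar> \<le> 1"
        by (simp flip: diff_divide_distrib)
      then show "\<bar>f (x i) - h (x i)\<bar> \<le> r"
        using r by simp
    qed (use r in simp)
    then show "\<exists>h\<in>C. emp_norm x I (\<lambda>y. f y - h y) \<le> r"
      using \<open>h \<in> C\<close> by (rule bexI)
  qed
  ultimately show ?thesis
    by (intro exI[of _ C] conjI)
qed

section \<open>Chaining for a pseudometric\<close>

text \<open>The weights \<open>2\<^bsup>j/2\<^esup>\<close> are written as powers of \<open>sqrt 2\<close> from here on.\<close>

lemma two_powr_half: "2 powr (real n / 2) = sqrt 2 ^ n"
  by (simp add: powr_half_sqrt [symmetric] powr_realpow [symmetric] powr_powr)

lemma sqrt2_power_power2: "(sqrt 2 ^ n)\<^sup>2 = 2 ^ n"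
  by (metis power_mult mult.commute real_sqrt_pow2 zero_le_numeral)

lemma sum_sqrt2_power_le: "(\<Sum>j=s..u. sqrt 2 ^ j) \<le> 4 * sqrt 2 ^ u"
proof -
  have "(\<Sum>j\<le>u. sqrt 2 ^ j) \<le> 4 * sqrt 2 ^ u"
  proof (induction u)
    case (Suc u)
    have "sqrt 2 \<ge> (4/3 :: real)"
      by (rule real_le_rsqrt) (simp add: power2_eq_square)
    then have "4 * sqrt 2 ^ u \<le> 3 * sqrt 2 * sqrt 2 ^ u"
      by (intro mult_right_mono) auto
    with Suc show ?case
      unfolding sum.atMost_Suc power_Suc by linarith
  qed simp
  moreover have "(\<Sum>j=s..u. sqrt 2 ^ j) \<le> (\<Sum>j\<le>u. sqrt 2 ^ j)"
    by (intro sum_mono2) auto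
  ultimately show ?thesis
    by linarith
qed

lemma sum_sqrt2_power_tail_le: "(\<Sum>j=Suc u..<n. sqrt 2 ^ j / 2 ^ (j - u)) \<le> 5 / 2 * sqrt 2 ^ u"
proof -
  define q where "q = 1 / sqrt 2"
  have q0: "q > 0"
    by (simp add: q_def)
  have "q \<le> 5 / 7"
    using real_le_rsqrt[of "7/5" 2] by (simp add: q_def power2_eq_square field_simps)
  then have q: "q \<le> 5 / 2 * (1 - q)"
    by simp
  have term_eq: "sqrt 2 ^ (u + i) / 2 ^ i = sqrt 2 ^ u * q ^ i" for i
  proof -
    have "sqrt 2 / 2 = q"
      by (simp add: q_def field_simps)
    then show ?thesis
      by (simp add: power_add flip: power_divide)
  qed
  have "(\<Sum>i=1..<k. q ^ i) \<le> 5 / 2 * (1 - q ^ (k - 1))" for k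
  proof (induction k)
    case (Suc k)
    show ?case
    proof (cases "k = 0")
      case False
      have "q ^ k = q ^ (k - 1) * q"
        using False by (metis power_minus_mult bot_nat_0.not_eq_extremum)
      moreover have "q ^ (k - 1) * q \<le> q ^ (k - 1) * (5 / 2 * (1 - q))"
        using q q0 by (intro mult_left_mono) auto
      ultimately show ?thesis
        using Suc False by (simp add: algebra_simps)
    qed simp
  qed simp
  moreover have "5 / 2 * (1 - q ^ (k - 1)) \<le> 5 / 2" for k
    using q0 by simp
  ultimately have geo: "(\<Sum>i=1..<k. q ^ i) \<le> 5 / 2" for k
    by (meson order_trans)
  have "(\<Sum>j=Suc u..<n. sqrt 2 ^ j / 2 ^ (j - u)) = (\<Sum>i=1..<n - u. sqrt 2 ^ u * q ^ i)"
    by (rule sum.reindex_bij_witness[of _ "\<lambda>i. u + i" "\<lambda>j. j - u"])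
      (auto simp flip: term_eq)
  also have "\<dots> = sqrt 2 ^ u * (\<Sum>i=1..<n - u. q ^ i)"
    by (simp add: sum_distrib_left)
  also have "\<dots> \<le> sqrt 2 ^ u * (5 / 2)"
    by (intro mult_left_mono geo) auto
  finally show ?thesis
    by (simp add: mult.commute)
qed

text \<open>Each distance \<open>d f (p j)\<close> is at most the length of the rest of the chain.  After exchanging the two
  summations, the link \<open>i\<close> carries the weight \<open>\<Sum>\<^bsub>j \<le> min i u\<^esub> 2\<^bsup>j/2\<^esup>\<close>, a geometric sum dominated by
  its last term.  Links beyond \<open>u\<close> only carry the weight of level \<open>u\<close>, which is why the hypothesis
  involves \<open>min i u\<close>.  All sums are finite; the tail of the chain enters through the limit.\<close>

lemma chain_sum_le:
  fixes d :: "'t \<Rightarrow> 't \<Rightarrow> real"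
  assumes tri: "\<And>x y z. d x z \<le> d x y + d y z" and nonneg: "\<And>x y. 0 \<le> d x y"
    and lim: "(\<lambda>n. d f (p n)) \<longlonglongrightarrow> 0"
    and Q: "\<And>n. (\<Sum>i=s..<n. sqrt 2 ^ min i u * d (p (Suc i)) (p i)) \<le> Q"
  shows "(\<Sum>j=s..u. sqrt 2 ^ j * d f (p j)) \<le> 4 * Q"
proof -
  let ?e = "\<lambda>i. d (p (Suc i)) (p i)"
  have chain: "d f (p j) \<le> d f (p n) + (\<Sum>i=j..<n. ?e i)" if "j \<le> n" for j n
    using that
  proof (induction n rule: dec_induct)
    case (step n)
    with tri[of f "p n" "p (Suc n)"] show ?case
      by (simp add: sum.atLeastLessThan_Suc)
  qed simp
  have bound: "(\<Sum>j=s..u. sqrt 2 ^ j * d f (p j)) \<le> (\<Sum>j=s..u. sqrt 2 ^ j) * d f (p n) + 4 * Q"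
    if n: "n \<ge> u" for n
  proof -
    have "(\<Sum>j=s..u. sqrt 2 ^ j * d f (p j)) \<le>
        (\<Sum>j=s..u. sqrt 2 ^ j * (d f (p n) + (\<Sum>i=j..<n. ?e i)))"
      using n by (intro sum_mono mult_left_mono chain) auto
    also have "\<dots> = (\<Sum>j=s..u. sqrt 2 ^ j) * d f (p n) +
        (\<Sum>j=s..u. \<Sum>i=j..<n. sqrt 2 ^ j * ?e i)"
      by (simp add: distrib_left sum.distrib sum_distrib_left sum_distrib_right)
    also have "(\<Sum>j=s..u. \<Sum>i=j..<n. sqrt 2 ^ j * ?e i) =
        (\<Sum>i=s..<n. \<Sum>j=s..min i u. sqrt 2 ^ j * ?e i)"
      unfolding sum.Sigma[OF finite_atLeastAtMost ballI[OF finite_atLeastLessThan]]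
        sum.Sigma[OF finite_atLeastLessThan ballI[OF finite_atLeastAtMost]]
      by (rule sum.reindex_bij_witness[of _ "\<lambda>(i, j). (j, i)" "\<lambda>(j, i). (i, j)"]) auto
    also have "\<dots> \<le> (\<Sum>i=s..<n. 4 * (sqrt 2 ^ min i u * ?e i))"
    proof (rule sum_mono)
      fix i
      have "(\<Sum>j=s..min i u. sqrt 2 ^ j * ?e i) = (\<Sum>j=s..min i u. sqrt 2 ^ j) * ?e i"
        by (simp add: sum_distrib_right)
      also have "\<dots> \<le> 4 * sqrt 2 ^ min i u * ?e i"
        by (intro mult_right_mono sum_sqrt2_power_le nonneg)
      finally show "(\<Sum>j=s..min i u. sqrt 2 ^ j * ?e i) \<le> 4 * (sqrt 2 ^ min i u * ?e i)"
        by simp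
    qed
    also have "\<dots> \<le> 4 * Q"
      using Q[of n] by (simp flip: sum_distrib_left)
    finally show ?thesis
      by simp
  qed
  have "(\<lambda>n. (\<Sum>j=s..u. sqrt 2 ^ j) * d f (p n) + 4 * Q) \<longlonglongrightarrow> (\<Sum>j=s..u. sqrt 2 ^ j) * 0 + 4 * Q"
    by (intro tendsto_intros lim)
  then show ?thesis
    using bound by (intro LIMSEQ_le_const) auto
qed

lemma admissible_seq_finite: "admissible_seq T A \<Longrightarrow> finite (A j)"
  unfolding admissible_seq_def
  by (metis card.infinite less_one linorder_not_le zero_neq_one)

lemma admissible_seq_card: "admissible_seq T A \<Longrightarrow> card (A j) \<le> 2 ^ 2 ^ j"
  unfolding admissible_seq_def by (cases "j = 0") auto

text \<open>The distance to a finite nonempty set is attained.  No set of level \<open>s\<close> or higher can be empty,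
  since the distance to the empty set is infinite.\<close>

lemma nearest_points:
  assumes adm: "admissible_seq T A" and nonneg: "\<And>x y. 0 \<le> d x y" and "0 \<le> G"
    and le: "(\<Sum>j. ennreal (2 powr (real (j + s) / 2)) * set_dist d t (A (j + s))) \<le> ennreal G"
  shows "\<exists>p. (\<forall>j\<ge>s. p j \<in> A j) \<and> (\<forall>n. (\<Sum>j=s..<n. sqrt 2 ^ j * d t (p j)) \<le> G)"
proof -
  let ?g = "\<lambda>j. ennreal (2 powr (real (j + s) / 2)) * set_dist d t (A (j + s))"
  have "\<exists>y\<in>A j. ennreal (d t y) \<le> set_dist d t (A j)" if "j \<ge> s" for j
  proof -
    have "A j \<noteq> {}"
    proof
      assume "A j = {}"
      then have "?g (j - s) = \<top>"
        using that by (simp add: set_dist_def ennreal_mult_top)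
      moreover have "?g (j - s) \<le> (\<Sum>j. ?g j)"
        using sum_le_suminf[of ?g "{j - s}"] by simp
      ultimately have "ennreal G = \<top>"
        using le by (metis top.extremum_uniqueI)
      then show False
        by simp
    qed
    moreover have "finite (A j)"
      using adm by (rule admissible_seq_finite)
    ultimately obtain y where "y \<in> A j" "\<And>z. z \<in> A j \<Longrightarrow> d t y \<le> d t z"
      using ex_is_arg_min_if_finite[of "A j" "d t"] by (force simp: is_arg_min_linorder)
    then show ?thesis
      by (intro bexI[of _ y]) (auto simp: set_dist_def intro!: INF_greatest ennreal_leI)
  qed
  then obtain p where p: "\<And>j. j \<ge> s \<Longrightarrow> p j \<in> A j"
      "\<And>j. j \<ge> s \<Longrightarrow> ennreal (d t (p j)) \<le> set_dist d t (A j)"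
    by metis
  have "(\<Sum>j=s..<n. sqrt 2 ^ j * d t (p j)) \<le> G" for n
  proof -
    have "ennreal (\<Sum>j=s..<n. sqrt 2 ^ j * d t (p j)) = (\<Sum>j=s..<n. ennreal (sqrt 2 ^ j * d t (p j)))"
      using nonneg by (simp add: sum_ennreal)
    also have "\<dots> = (\<Sum>j<n - s. ennreal (sqrt 2 ^ (j + s) * d t (p (j + s))))"
      by (simp add: sum.atLeastLessThan_shift_0[of _ s] lessThan_atLeast0 add.commute)
    also have "\<dots> \<le> (\<Sum>j<n - s. ?g j)"
    proof (rule sum_mono)
      fix j
      show "ennreal (sqrt 2 ^ (j + s) * d t (p (j + s))) \<le> ?g j"
        using p(2)[of "j + s"] unfolding two_powr_half
        by (simp add: ennreal_mult nonneg mult_left_mono)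
    qed
    also have "\<dots> \<le> (\<Sum>j. ?g j)"
      by (intro sum_le_suminf) auto
    finally show ?thesis
      using le \<open>0 \<le> G\<close> by (meson ennreal_le_iff order_trans)
  qed
  with p(1) show ?thesis
    by blast
qed

text \<open>Partial sums of the defining series depend continuously on the point, so that it suffices to
  exhibit approximating points for a dense subset.\<close>

lemma gamma2_le_dense:
  assumes adm: "admissible_seq T B" and "0 \<le> P"
    and tri: "\<And>x y z. d x z \<le> d x y + d y z" and nonneg: "\<And>x y. 0 \<le> d x y"
    and dense: "\<And>t \<epsilon>. t \<in> T \<Longrightarrow> 0 < \<epsilon> \<Longrightarrow> \<exists>f\<in>D. d t f < \<epsilon>"
    and bound: "\<And>f n. f \<in> D \<Longrightarrow>
      \<exists>p. (\<forall>j\<in>{s..<n}. p j \<in> B j) \<and> (\<Sum>j=s..<n. sqrt 2 ^ j * d f (p j)) \<le> P"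
  shows "gamma2 s T d \<le> ennreal P"
proof -
  let ?g = "\<lambda>t j. ennreal (2 powr (real (j + s) / 2)) * set_dist d t (B (j + s))"
  have "(\<Sum>j<n. ?g t j) \<le> ennreal P" if t: "t \<in> T" for t n
  proof (rule ennreal_le_epsilon)
    fix e :: real assume e: "e > 0"
    \<comment> \<open>the Lipschitz constant of the partial sum; \<open>w + 1\<close> below avoids division by zero\<close>
    define w where "w = (\<Sum>j=s..<s + n. sqrt 2 ^ j)"
    have w: "w \<ge> 0"
      by (simp add: w_def sum_nonneg)
    then have "e / (w + 1) > 0"
      using e by simp
    with dense t obtain f where f: "f \<in> D" "d t f < e / (w + 1)"
      by blast
    from bound[OF f(1)] obtain p where p: "\<And>j. j \<in> {s..<s + n} \<Longrightarrow> p j \<in> B j"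
        "(\<Sum>j=s..<s + n. sqrt 2 ^ j * d f (p j)) \<le> P"
      by meson
    have "(\<Sum>j<n. ?g t j) = (\<Sum>j=s..<s + n. ennreal (sqrt 2 ^ j) * set_dist d t (B j))"
      unfolding two_powr_half
      by (simp add: sum.atLeastLessThan_shift_0[of _ s] lessThan_atLeast0 add.commute)
    also have "\<dots> \<le> (\<Sum>j=s..<s + n. ennreal (sqrt 2 ^ j * (d t f + d f (p j))))"
    proof (rule sum_mono)
      fix j assume j: "j \<in> {s..<s + n}"
      have "set_dist d t (B j) \<le> ennreal (d t (p j))"
        unfolding set_dist_def by (intro INF_lower p j)
      also have "\<dots> \<le> ennreal (d t f + d f (p j))"
        by (intro ennreal_leI tri)
      finally show "ennreal (sqrt 2 ^ j) * set_dist d t (B j) \<le> ennreal (sqrt 2 ^ j * (d t f + d f (p j)))"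
        by (simp add: ennreal_mult nonneg mult_left_mono del: ennreal_plus)
    qed
    also have "\<dots> = ennreal (\<Sum>j=s..<s + n. sqrt 2 ^ j * (d t f + d f (p j)))"
      by (intro sum_ennreal) (simp add: nonneg)
    also have "\<dots> \<le> ennreal (P + e)"
    proof (rule ennreal_leI)
      have "(\<Sum>j=s..<s + n. sqrt 2 ^ j * (d t f + d f (p j))) =
          w * d t f + (\<Sum>j=s..<s + n. sqrt 2 ^ j * d f (p j))"
        by (simp add: distrib_left sum.distrib w_def sum_distrib_right)
      also have "\<dots> \<le> w * (e / (w + 1)) + P"
        using f(2) w p(2) by (intro add_mono mult_left_mono) auto
      also have "w * (e / (w + 1)) \<le> e"
        using w e by (simp add: field_simps)
      finally show "(\<Sum>j=s..<s + n. sqrt 2 ^ j * (d t f + d f (p j))) \<le> P + e"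
        by simp
    qed
    finally show "(\<Sum>j<n. ?g t j) \<le> ennreal P + ennreal e"
      using \<open>0 \<le> P\<close> e by simp
  qed
  then have "(SUP t\<in>T. \<Sum>j. ?g t j) \<le> ennreal P"
    by (auto simp: suminf_eq_SUP intro!: SUP_least)
  moreover have "gamma2 s T d \<le> (SUP t\<in>T. \<Sum>j. ?g t j)"
    unfolding gamma2_def using adm by (intro INF_lower) simp
  ultimately show ?thesis
    by (rule order_trans[rotated])
qed

section \<open>Refining a net above the dimension level\<close>

text \<open>The net at level \<open>u + 3 + i\<close> consists of a net of radius \<open>2\<^sup>-\<^sup>i R\<close> in each of the \<open>N\<close> balls of
  radius \<open>R\<close> around the points of level \<open>u\<close>.  Its cardinality is admissible because the dimension
  \<open>m\<close> is at most \<open>2\<^sup>u\<close> and \<open>i + 5 \<le> 8 2\<^sup>i\<close>.\<close>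

lemma nested_cell_count:
  assumes m: "m \<le> (2::nat) ^ u" and N: "N \<le> (2::nat) ^ 2 ^ u"
  shows "real N * (exp 1 * (3 + 2 * 2 ^ i)) ^ m \<le> 2 ^ 2 ^ (u + 3 + i)"
proof -
  have "exp 1 * (3 + 2 * 2 ^ i) \<le> (3 :: real) * (5 * 2 ^ i)"
    using exp_le by (intro mult_mono) auto
  also have "\<dots> \<le> 2 ^ (i + 4)"
    by (simp add: power_add)
  finally have "(exp 1 * (3 + 2 * 2 ^ i)) ^ m \<le> ((2 :: real) ^ (i + 4)) ^ m"
    by (intro power_mono) (auto intro!: add_nonneg_nonneg)
  also have "\<dots> \<le> (2 ^ (i + 4)) ^ 2 ^ u"
    using m by (intro power_increasing) auto
  finally have "real N * (exp 1 * (3 + 2 * 2 ^ i)) ^ m \<le> 2 ^ 2 ^ u * (2 ^ (i + 4)) ^ 2 ^ u"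
  proof (intro mult_mono)
    show "real N \<le> 2 ^ 2 ^ u"
      using N by (metis of_nat_le_iff of_nat_numeral of_nat_power)
  qed (auto intro!: add_nonneg_nonneg zero_le_power)
  also have "\<dots> = 2 ^ ((i + 5) * 2 ^ u)"
    by (simp add: power_mult [symmetric] power_add [symmetric] algebra_simps)
  also have "\<dots> \<le> (2 :: real) ^ 2 ^ (u + 3 + i)"
  proof (rule power_increasing)
    have "i < 2 ^ i"
      by (rule less_exp)
    then have "i + 5 \<le> 8 * 2 ^ i"
      by linarith
    then have "(i + 5) * 2 ^ u \<le> 8 * 2 ^ i * 2 ^ u"
      by (rule mult_right_mono) simp
    then show "(i + 5) * 2 ^ u \<le> 2 ^ (u + 3 + i)"
      by (simp add: power_add algebra_simps)
  qed simp
  finally show ?thesis .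
qed

text \<open>If \<open>2\<^sup>u\<close> is at least the number of coordinates, only the levels up to \<open>u\<close> matter.  They provide a
  net of radius \<open>R = 2\<^bsup>-u/2\<^esup> P\<close> at level \<open>u\<close>, which can be refined by a factor \<open>2\<close> at each further
  level, after a delay of three levels that absorbs the constants.  Since the weights grow only by
  \<open>sqrt 2\<close> per level, the refined levels contribute at most \<open>20 P\<close>.\<close>

lemma gamma2_emp_norm_le:
  fixes x :: "nat \<Rightarrow> 'a"
  defines "d \<equiv> \<lambda>I f g :: 'a \<Rightarrow> real. emp_norm x I (\<lambda>y. f y - g y)"
  assumes adm: "admissible_seq F A" and I: "finite I" "card I \<le> 2 ^ u"
    and P: "P > 0" and s: "s \<le> u" "s \<le> s'"
    and D: "D \<subseteq> F" and dense: "\<And>t \<epsilon>. t \<in> F \<Longrightarrow> 0 < \<epsilon> \<Longrightarrow> \<exists>f\<in>D. d I t f < \<epsilon>"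
    and bound: "\<And>f. f \<in> D \<Longrightarrow>
      \<exists>p. (\<forall>j\<in>{s..u}. p j \<in> A j) \<and> (\<Sum>j=s..u. sqrt 2 ^ j * d I f (p j)) \<le> P"
  shows "gamma2 s' F (d I) \<le> ennreal (21 * P)"
proof -
  define R where "R = P / sqrt 2 ^ u"
  have R: "R > 0" and PR: "P = R * sqrt 2 ^ u"
    using P by (simp_all add: R_def)
  have nonneg: "0 \<le> d I f g" for f g
    by (simp add: d_def)
  have near: "d I f (p u) \<le> R" if "(\<Sum>j=s..u. sqrt 2 ^ j * d I f (p j)) \<le> P" for f p
  proof -
    have "sqrt 2 ^ u * d I f (p u) \<le> (\<Sum>j=s..u. sqrt 2 ^ j * d I f (p j))"
      using s by (intro member_le_sum) (auto simp: nonneg)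
    with that have "sqrt 2 ^ u * d I f (p u) \<le> P"
      by simp
    then show ?thesis
      by (simp add: R_def field_simps)
  qed
  have "\<exists>C\<subseteq>D. finite C \<and> card C \<le> 2 ^ 2 ^ (u + 3 + i) \<and> (\<forall>f\<in>D. \<exists>h\<in>C. d I f h \<le> R / 2 ^ i)" for i
  proof -
    define S where "S g = {f \<in> D. d I f g \<le> R}" for g
    have "\<exists>C\<subseteq>S g. finite C \<and> real (card C) \<le> (exp 1 * (3 + 2 * (R / (R / 2 ^ i)))) ^ card I \<and>
        (\<forall>f\<in>S g. \<exists>h\<in>C. d I f h \<le> R / 2 ^ i)" for g
      unfolding d_def by (rule emp_norm_ball_cover) (use I R in \<open>auto simp: S_def d_def\<close>)
    then have "\<forall>g. \<exists>C\<subseteq>S g. finite C \<and> real (card C) \<le> (exp 1 * (3 + 2 * 2 ^ i)) ^ card I \<and>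
        (\<forall>f\<in>S g. \<exists>h\<in>C. d I f h \<le> R / 2 ^ i)"
      using R by simp
    then obtain C where C: "\<And>g. C g \<subseteq> S g" "\<And>g. finite (C g)"
        "\<And>g. real (card (C g)) \<le> (exp 1 * (3 + 2 * 2 ^ i)) ^ card I"
        "\<And>g f. f \<in> S g \<Longrightarrow> \<exists>h\<in>C g. d I f h \<le> R / 2 ^ i"
      by metis
    define U where "U = (\<Union>g\<in>A u. C g)"
    have fin: "finite (A u)"
      using adm by (rule admissible_seq_finite)
    have "U \<subseteq> D"
      using C(1) by (auto simp: U_def S_def)
    moreover have "finite U"
      using fin C(2) by (simp add: U_def)
    moreover have "card U \<le> 2 ^ 2 ^ (u + 3 + i)"
    proof -
      have "card U \<le> (\<Sum>g\<in>A u. card (C g))"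
        unfolding U_def by (rule card_UN_le[OF fin])
      then have "real (card U) \<le> (\<Sum>g\<in>A u. real (card (C g)))"
        by (metis of_nat_mono of_nat_sum)
      also have "\<dots> \<le> (\<Sum>g\<in>A u. (exp 1 * (3 + 2 * 2 ^ i)) ^ card I)"
        by (intro sum_mono C)
      also have "\<dots> \<le> 2 ^ 2 ^ (u + 3 + i)"
        using nested_cell_count[OF I(2) admissible_seq_card[OF adm]] by simp
      finally show ?thesis
        by (metis of_nat_le_iff of_nat_numeral of_nat_power)
    qed
    moreover have "\<forall>f\<in>D. \<exists>h\<in>U. d I f h \<le> R / 2 ^ i"
    proof
      fix f assume f: "f \<in> D"
      obtain p where p: "\<forall>j\<in>{s..u}. p j \<in> A j" "(\<Sum>j=s..u. sqrt 2 ^ j * d I f (p j)) \<le> P"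
        using bound[OF f] by blast
      have "f \<in> S (p u)" "p u \<in> A u"
        using near[OF p(2)] f p(1) s by (auto simp: S_def)
      with C(4) show "\<exists>h\<in>U. d I f h \<le> R / 2 ^ i"
        unfolding U_def by blast
    qed
    ultimately show ?thesis
      by (intro exI[of _ U] conjI)
  qed
  then obtain C where C: "\<And>i. C i \<subseteq> D" "\<And>i. finite (C i)" "\<And>i. card (C i) \<le> 2 ^ 2 ^ (u + 3 + i)"
      "\<And>i f. f \<in> D \<Longrightarrow> \<exists>h\<in>C i. d I f h \<le> R / 2 ^ i"
    by metis
  \<comment> \<open>The cardinalities of the refined nets are admissible only from level \<open>u + 3\<close> on.\<close>
  define B where "B j = (if j \<le> u then A j else if j < u + 3 then A u else C (j - (u + 3)))" for j
  have "admissible_seq F B"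
  proof -
    have "card (B j) \<le> 2 ^ 2 ^ j" for j
    proof -
      have "card (A u) \<le> 2 ^ 2 ^ j" if "u < j"
      proof -
        have "(2::nat) ^ 2 ^ u \<le> 2 ^ 2 ^ j"
          using that by (intro power_increasing) auto
        with admissible_seq_card[OF adm, of u] show ?thesis
          by linarith
      qed
      then show ?thesis
        using admissible_seq_card[OF adm] C(3)[of "j - (u + 3)"] by (auto simp: B_def)
    qed
    moreover have "finite (B j)" for j
      using C(2) admissible_seq_finite[OF adm] by (auto simp: B_def)
    moreover have "B j \<subseteq> F" for j
      using C(1) D adm by (auto simp: B_def admissible_seq_def)
    ultimately show ?thesis
      using adm by (auto simp: admissible_seq_def B_def)
  qed
  then show ?thesis
  proof (rule gamma2_le_dense)
    show "d I f h \<le> d I f g + d I g h" for f g h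
      unfolding d_def by (rule emp_norm_triangle)
    fix f n assume f: "f \<in> D"
    obtain p where p: "\<And>j. j \<in> {s..u} \<Longrightarrow> p j \<in> A j" "(\<Sum>j=s..u. sqrt 2 ^ j * d I f (p j)) \<le> P"
      using bound[OF f] by meson
    obtain q where q: "\<And>i. q i \<in> C i" "\<And>i. d I f (q i) \<le> R / 2 ^ i"
      using C(4)[OF f] by metis
    define r where "r j = (if j \<le> u then p j else if j < u + 3 then p u else q (j - (u + 3)))" for j
    \<comment> \<open>The factor \<open>8\<close> stems from the delay of three levels.\<close>
    have tail: "d I f (r j) \<le> 8 * R / 2 ^ (j - u)" if "u < j" for j
    proof (cases "j < u + 3")
      case True
      then have "j = Suc u \<or> j = Suc (Suc u)"
        using that by auto
      then have "R \<le> 8 * R / 2 ^ (j - u)"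
        using R by auto
      with near[OF p(2)] show ?thesis
        using True that by (auto simp: r_def)
    next
      case False
      then obtain i where "j = u + 3 + i"
        using le_Suc_ex by (metis not_less)
      then show ?thesis
        using q(2)[of i] by (simp add: r_def power_add)
    qed
    have "(\<Sum>j=s'..<n. sqrt 2 ^ j * d I f (r j)) \<le>
        (\<Sum>j\<in>{s..u} \<union> {Suc u..<n}. sqrt 2 ^ j * d I f (r j))"
      using s by (intro sum_mono2) (auto simp: nonneg)
    also have "\<dots> = (\<Sum>j=s..u. sqrt 2 ^ j * d I f (r j)) + (\<Sum>j=Suc u..<n. sqrt 2 ^ j * d I f (r j))"
      by (intro sum.union_disjoint) auto
    also have "(\<Sum>j=s..u. sqrt 2 ^ j * d I f (r j)) = (\<Sum>j=s..u. sqrt 2 ^ j * d I f (p j))"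
      by (intro sum.cong) (auto simp: r_def)
    also have "(\<Sum>j=Suc u..<n. sqrt 2 ^ j * d I f (r j)) \<le>
        (\<Sum>j=Suc u..<n. 8 * R * (sqrt 2 ^ j / 2 ^ (j - u)))"
    proof (rule sum_mono)
      fix j assume "j \<in> {Suc u..<n}"
      then have "sqrt 2 ^ j * d I f (r j) \<le> sqrt 2 ^ j * (8 * R / 2 ^ (j - u))"
        by (intro mult_left_mono tail) auto
      then show "sqrt 2 ^ j * d I f (r j) \<le> 8 * R * (sqrt 2 ^ j / 2 ^ (j - u))"
        by (simp add: mult_ac)
    qed
    also have "\<dots> \<le> 8 * R * (5 / 2 * sqrt 2 ^ u)"
      unfolding sum_distrib_left [symmetric] using R
      by (intro mult_left_mono sum_sqrt2_power_tail_le) auto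
    finally have "(\<Sum>j=s'..<n. sqrt 2 ^ j * d I f (r j)) \<le> 21 * P"
      using p(2) by (simp add: PR)
    moreover have "\<forall>j\<in>{s'..<n}. r j \<in> B j"
      using p(1) q(1) s by (auto simp: r_def B_def)
    ultimately show "\<exists>p. (\<forall>j\<in>{s'..<n}. p j \<in> B j) \<and> (\<Sum>j=s'..<n. sqrt 2 ^ j * d I f (p j)) \<le> 21 * P"
      by blast
  qed (use P dense nonneg in auto)
qed

section \<open>Deviation of empirical norms\<close>

lemma psi2_norm_exp_moment:
  assumes "psi2_norm M h < ennreal C"
  shows "(\<integral>\<^sup>+x. ennreal (exp ((h x)\<^sup>2 / C\<^sup>2)) \<partial>M) \<le> 2"
proof -
  obtain C' where C': "0 < C'" "ennreal C' < ennreal C"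
      "(\<integral>\<^sup>+x. ennreal (exp (\<bar>h x\<bar>\<^sup>2 / C'\<^sup>2)) \<partial>M) \<le> 2"
    using assms unfolding psi2_norm_def INF_less_iff by auto
  then have "C' < C"
    by (simp add: ennreal_less_iff)
  then have "(\<integral>\<^sup>+x. ennreal (exp ((h x)\<^sup>2 / C\<^sup>2)) \<partial>M) \<le> (\<integral>\<^sup>+x. ennreal (exp (\<bar>h x\<bar>\<^sup>2 / C'\<^sup>2)) \<partial>M)"
    using C'(1) by (intro nn_integral_mono ennreal_leI) (auto intro!: divide_left_mono power_mono)
  with C'(3) show ?thesis
    by (rule order_trans[rotated])
qed

text \<open>The exponential moments multiply by independence, and \<open>2 \<le> e\<close> accounts for the term \<open>card I\<close>.\<close>

lemma sum_squares_deviation: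
  assumes "prob_space N" and indep: "prob_space.indep_vars N (\<lambda>_. M) X K"
    and distr: "\<And>i. i \<in> K \<Longrightarrow> distr N M (X i) = M"
    and I: "I \<subseteq> K" "finite I" and h: "h \<in> borel_measurable M" and C: "C > 0"
    and moment: "(\<integral>\<^sup>+x. ennreal (exp ((h x)\<^sup>2 / C\<^sup>2)) \<partial>M) \<le> 2"
  shows "emeasure N {\<omega> \<in> space N. C\<^sup>2 * (real (card I) + v) < (\<Sum>i\<in>I. (h (X i \<omega>))\<^sup>2)}
    \<le> ennreal (exp (- v))"
proof -
  interpret N: prob_space N by fact
  have X: "X i \<in> measurable N M" if "i \<in> I" for i
    using indep I that by (auto simp: N.indep_vars_def)
  let ?u = "\<lambda>i \<omega>. ennreal (exp ((h (X i \<omega>))\<^sup>2 / C\<^sup>2))"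
  have hX: "(\<lambda>\<omega>. h (X i \<omega>)) \<in> borel_measurable N" if "i \<in> I" for i
    using measurable_compose[OF X[OF that] h] .
  have meas: "?u i \<in> borel_measurable N" if "i \<in> I" for i
    using hX[OF that] by measurable
  have "N.indep_vars (\<lambda>_. borel) ?u I"
    by (rule N.indep_vars_compose2[OF N.indep_vars_subset[OF indep I(1)]]) (use h in measurable)
  then have "(\<integral>\<^sup>+\<omega>. (\<Prod>i\<in>I. ?u i \<omega>) \<partial>N) = (\<Prod>i\<in>I. \<integral>\<^sup>+\<omega>. ?u i \<omega> \<partial>N)"
    using I by (intro N.indep_vars_nn_integral) auto
  also have "\<dots> \<le> (\<Prod>i\<in>I. 2)"
  proof (intro prod_mono_ennreal)
    fix i assume i: "i \<in> I"
    have "(\<integral>\<^sup>+\<omega>. ?u i \<omega> \<partial>N) = (\<integral>\<^sup>+x. ennreal (exp ((h x)\<^sup>2 / C\<^sup>2)) \<partial>distr N M (X i))"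
      using h X[OF i] by (subst nn_integral_distr) auto
    with moment distr I i show "(\<integral>\<^sup>+\<omega>. ?u i \<omega> \<partial>N) \<le> 2"
      by auto
  qed
  finally have prod: "(\<integral>\<^sup>+\<omega>. (\<Prod>i\<in>I. ?u i \<omega>) \<partial>N) \<le> 2 ^ card I"
    by simp
  let ?c = "ennreal (exp (- (real (card I) + v)))"
  have "{\<omega> \<in> space N. C\<^sup>2 * (real (card I) + v) < (\<Sum>i\<in>I. (h (X i \<omega>))\<^sup>2)}
      \<subseteq> {\<omega> \<in> space N. 1 \<le> ?c * (\<Prod>i\<in>I. ?u i \<omega>)}"
  proof (intro Collect_mono impI conjI; elim conjE)
    fix \<omega> assume le: "C\<^sup>2 * (real (card I) + v) < (\<Sum>i\<in>I. (h (X i \<omega>))\<^sup>2)"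
    have "(\<Prod>i\<in>I. ?u i \<omega>) = ennreal (exp ((\<Sum>i\<in>I. (h (X i \<omega>))\<^sup>2) / C\<^sup>2))"
      using I by (simp add: prod_ennreal exp_sum sum_divide_distrib)
    then have "?c * (\<Prod>i\<in>I. ?u i \<omega>) =
        ennreal (exp ((\<Sum>i\<in>I. (h (X i \<omega>))\<^sup>2) / C\<^sup>2 - (real (card I) + v)))"
      by (simp add: ennreal_mult [symmetric] exp_add [symmetric] algebra_simps)
    moreover have "real (card I) + v \<le> (\<Sum>i\<in>I. (h (X i \<omega>))\<^sup>2) / C\<^sup>2"
      using le C by (simp add: field_simps)
    ultimately show "1 \<le> ?c * (\<Prod>i\<in>I. ?u i \<omega>)"
      by simp
  qed auto
  then have "emeasure N {\<omega> \<in> space N. C\<^sup>2 * (real (card I) + v) < (\<Sum>i\<in>I. (h (X i \<omega>))\<^sup>2)}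
      \<le> emeasure N {\<omega> \<in> space N. 1 \<le> ?c * (\<Prod>i\<in>I. ?u i \<omega>)}"
    by (rule emeasure_mono) (use meas in measurable)
  also have "\<dots> \<le> ?c * (\<integral>\<^sup>+\<omega>. (\<Prod>i\<in>I. ?u i \<omega>) * indicator (space N) \<omega> \<partial>N)"
    by (rule order_trans[OF _ nn_integral_Markov_inequality]) (use meas in auto)
  also have "\<dots> = ?c * (\<integral>\<^sup>+\<omega>. (\<Prod>i\<in>I. ?u i \<omega>) \<partial>N)"
    by (intro arg_cong2[where f = "(*)"] nn_integral_cong) auto
  also have "\<dots> \<le> ?c * 2 ^ card I"
    by (intro mult_left_mono prod) auto
  also have "\<dots> = ennreal (exp (- (real (card I) + v)) * 2 ^ card I)"
    by (simp add: ennreal_mult ennreal_power [symmetric])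
  also have "\<dots> \<le> ennreal (exp (- v))"
  proof (rule ennreal_leI)
    have "(2::real) ^ card I \<le> exp 1 ^ card I"
      using exp_ge_add_one_self[of 1] by (intro power_mono) auto
    then have "exp (- (real (card I) + v)) * 2 ^ card I \<le> exp (- (real (card I) + v)) * exp (real (card I))"
      by (simp flip: exp_of_nat_mult)
    then show "exp (- (real (card I) + v)) * 2 ^ card I \<le> exp (- v)"
      by (simp flip: exp_add)
  qed
  finally show ?thesis .
qed

lemma L2_norm_nonneg [simp]: "0 \<le> L2_norm M f"
  by (simp add: L2_norm_def)

lemma L2_norm_power2: "(L2_norm M f)\<^sup>2 = (\<integral>x. (f x)\<^sup>2 \<partial>M)"
  by (simp add: L2_norm_def)

text \<open>Strictly above its infimum the \<open>\<psi>\<^sub>2\<close> norm gives an exponential moment; hence the factor \<open>4 = 2\<^sup>2\<close>.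
  If the \<open>L\<^sub>2\<close> norm vanishes, there is no room for such a factor, but then \<open>h\<close> vanishes almost
  everywhere.\<close>

lemma subgaussian_deviation:
  assumes "prob_space N" and indep: "prob_space.indep_vars N (\<lambda>_. M) X K"
    and distr: "\<And>i. i \<in> K \<Longrightarrow> distr N M (X i) = M"
    and I: "I \<subseteq> K" "finite I" and h: "h \<in> L2_space M" and L: "L > 0" and v: "v \<ge> 0"
    and psi2: "psi2_norm M h \<le> ennreal (L * L2_norm M h)"
  shows "emeasure N {\<omega> \<in> space N.
      4 * L\<^sup>2 * (L2_norm M h)\<^sup>2 * (real (card I) + v) < (\<Sum>i\<in>I. (h (X i \<omega>))\<^sup>2)} \<le> ennreal (exp (- v))"
proof (cases "L2_norm M h = 0")
  case True
  interpret N: prob_space N by fact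
  have X: "X i \<in> measurable N M" if "i \<in> I" for i
    using indep I that by (auto simp: N.indep_vars_def)
  have hm: "h \<in> borel_measurable M"
    using h by (simp add: L2_space_def)
  have "AE x in M. (h x)\<^sup>2 = 0"
    using h L2_norm_power2[of M h] True
    by (subst integral_nonneg_eq_0_iff_AE[symmetric]) (auto simp: L2_space_def)
  then have "AE x in M. h x = 0"
    by simp
  then have "AE x in distr N M (X i). h x = 0" if "i \<in> I" for i
    using distr[of i] I(1) that \<open>AE x in M. h x = 0\<close> by (simp only: subsetD)
  then have "AE \<omega> in N. h (X i \<omega>) = 0" if "i \<in> I" for i
    using AE_distrD[OF X[OF that]] that by blast
  then have "AE \<omega> in N. \<forall>i\<in>I. h (X i \<omega>) = 0"
    using I by (simp add: AE_finite_allI)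
  then have "AE \<omega> in N. \<not> 0 < (\<Sum>i\<in>I. (h (X i \<omega>))\<^sup>2)"
    by eventually_elim simp
  then have "emeasure N {\<omega> \<in> space N. 0 < (\<Sum>i\<in>I. (h (X i \<omega>))\<^sup>2)} = 0"
    by (rule emeasure_eq_0_AE)
  with True show ?thesis
    by simp
next
  case False
  then have pos: "L2_norm M h > 0"
    using L2_norm_nonneg[of M h] by linarith
  have "psi2_norm M h < ennreal (2 * L * L2_norm M h)"
    by (rule order.strict_trans1[OF psi2]) (use pos L in \<open>simp add: ennreal_less_iff\<close>)
  then have "(\<integral>\<^sup>+x. ennreal (exp ((h x)\<^sup>2 / (2 * L * L2_norm M h)\<^sup>2)) \<partial>M) \<le> 2"
    by (rule psi2_norm_exp_moment)
  from sum_squares_deviation[OF assms(1-5) _ _ this] pos L h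
  show ?thesis
    by (simp add: L2_space_def power_mult_distrib)
qed

lemma L2_space_diff:
  assumes "f \<in> L2_space M" "g \<in> L2_space M"
  shows "(\<lambda>x. f x - g x) \<in> L2_space M"
proof -
  have [measurable]: "f \<in> borel_measurable M" "g \<in> borel_measurable M"
    using assms by (auto simp: L2_space_def)
  have "integrable M (\<lambda>x. 2 * (f x)\<^sup>2 + 2 * (g x)\<^sup>2)"
    using assms by (auto simp: L2_space_def)
  then have "integrable M (\<lambda>x. (f x - g x)\<^sup>2)"
  proof (rule Bochner_Integration.integrable_bound)
    have "(f x - g x)\<^sup>2 \<le> 2 * (f x)\<^sup>2 + 2 * (g x)\<^sup>2" for x
      using zero_le_power2[of "f x + g x"] by (simp add: power2_eq_square algebra_simps)
    then show "AE x in M. norm ((f x - g x)\<^sup>2) \<le> norm (2 * (f x)\<^sup>2 + 2 * (g x)\<^sup>2)"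
      by simp
  qed measurable
  then show ?thesis
    by (simp add: L2_space_def)
qed

text \<open>The pointwise inequality \<open>(a + b)\<^sup>2 \<le> 2 a\<^sup>2 + 2 b\<^sup>2\<close> replaces Minkowski's inequality, at the price of
  a constant.\<close>

lemma L2_norm_quasi_triangle:
  assumes f: "f \<in> L2_space M" and g: "g \<in> L2_space M" and h: "h \<in> L2_space M"
  shows "L2_norm M (\<lambda>x. g x - h x) \<le> 2 * (L2_norm M (\<lambda>x. f x - g x) + L2_norm M (\<lambda>x. f x - h x))"
proof (rule power2_le_imp_le)
  have int: "integrable M (\<lambda>x. (u x - v x)\<^sup>2)" if "u \<in> L2_space M" "v \<in> L2_space M" for u v
    using L2_space_diff[OF that] by (simp add: L2_space_def)
  let ?a = "L2_norm M (\<lambda>x. f x - g x)" and ?b = "L2_norm M (\<lambda>x. f x - h x)"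
  have "(L2_norm M (\<lambda>x. g x - h x))\<^sup>2 \<le> (\<integral>x. 2 * (f x - g x)\<^sup>2 + 2 * (f x - h x)\<^sup>2 \<partial>M)"
    unfolding L2_norm_power2
  proof (rule integral_mono)
    fix x
    show "(g x - h x)\<^sup>2 \<le> 2 * (f x - g x)\<^sup>2 + 2 * (f x - h x)\<^sup>2"
      using zero_le_power2[of "(f x - g x) + (f x - h x)"]
      by (simp add: power2_eq_square algebra_simps)
  qed (use int f g h in auto)
  also have "\<dots> = 2 * ?a\<^sup>2 + 2 * ?b\<^sup>2"
    using int f g h by (simp add: L2_norm_power2)
  also have "\<dots> \<le> (2 * (?a + ?b))\<^sup>2"
    by (simp add: power2_eq_square algebra_simps)
  finally show "(L2_norm M (\<lambda>x. g x - h x))\<^sup>2 \<le> (2 * (?a + ?b))\<^sup>2" .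
qed simp

text \<open>The distances decay like \<open>2\<^bsup>-j/2\<^esup>\<close>, so the integrals of \<open>(f - p\<^sub>j)\<^sup>2\<close> are summable, and hence the
  squares are summable at almost every point.\<close>

lemma AE_chain_converges:
  assumes f: "f \<in> L2_space M" and p: "\<And>j. j \<ge> s \<Longrightarrow> p j \<in> L2_space M"
    and G: "\<And>n. (\<Sum>j=s..<n. sqrt 2 ^ j * L2_norm M (\<lambda>x. f x - p j x)) \<le> G"
  shows "AE x in M. (\<lambda>j. p j x) \<longlonglongrightarrow> f x"
proof -
  let ?u = "\<lambda>j x. (f x - p (j + s) x)\<^sup>2"
  have L2: "(\<lambda>x. f x - p (j + s) x) \<in> L2_space M" for j
    by (intro L2_space_diff f p) simp
  then have [measurable]: "?u j \<in> borel_measurable M" for j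
    using L2[of j] by (auto simp: L2_space_def intro: borel_measurable_power)
  have bound: "(\<integral>\<^sup>+x. ennreal (?u j x) \<partial>M) \<le> ennreal (G\<^sup>2 * (1 / 2) ^ j)" for j
  proof -
    let ?a = "L2_norm M (\<lambda>x. f x - p (j + s) x)"
    have "sqrt 2 ^ (j + s) * ?a \<le> (\<Sum>j=s..<Suc (j + s). sqrt 2 ^ j * L2_norm M (\<lambda>x. f x - p j x))"
      by (rule member_le_sum) auto
    also have "\<dots> \<le> G"
      by (rule G)
    finally have "(sqrt 2 ^ (j + s) * ?a)\<^sup>2 \<le> G\<^sup>2"
      by (intro power_mono) auto
    then have "2 ^ (j + s) * ?a\<^sup>2 \<le> G\<^sup>2"
      by (simp add: power_mult_distrib sqrt2_power_power2)
    moreover have "2 ^ j * ?a\<^sup>2 \<le> 2 ^ (j + s) * ?a\<^sup>2"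
      by (intro mult_right_mono power_increasing) auto
    ultimately have "?a\<^sup>2 \<le> G\<^sup>2 * (1 / 2) ^ j"
      by (simp add: field_simps power_divide)
    moreover have "(\<integral>\<^sup>+x. ennreal (?u j x) \<partial>M) = ennreal (?a\<^sup>2)"
      unfolding L2_norm_power2 using L2[of j] by (intro nn_integral_eq_integral) (auto simp: L2_space_def)
    ultimately show ?thesis
      by (simp add: ennreal_leI)
  qed
  have "(\<integral>\<^sup>+x. (\<Sum>j. ennreal (?u j x)) \<partial>M) = (\<Sum>j. \<integral>\<^sup>+x. ennreal (?u j x) \<partial>M)"
    by (rule nn_integral_suminf) measurable
  also have "\<dots> \<le> (\<Sum>j. ennreal (G\<^sup>2 * (1 / 2) ^ j))"
    by (intro suminf_le bound) auto
  also have "\<dots> = ennreal (\<Sum>j. G\<^sup>2 * (1 / 2) ^ j)"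
    by (rule suminf_ennreal2) (auto intro!: summable_mult summable_geometric)
  also have "\<dots> < \<infinity>"
    by simp
  finally have "AE x in M. (\<Sum>j. ennreal (?u j x)) \<noteq> \<infinity>"
    by (intro nn_integral_PInf_AE) auto
  then show ?thesis
  proof eventually_elim
    case (elim x)
    then have "summable (\<lambda>j. ?u j x)"
      by (intro summable_suminf_not_top) auto
    then have "(\<lambda>j. ?u j x) \<longlonglongrightarrow> 0"
      by (rule summable_LIMSEQ_zero)
    then have "(\<lambda>j. sqrt (?u j x)) \<longlonglongrightarrow> sqrt 0"
      by (rule tendsto_real_sqrt)
    then have "(\<lambda>j. f x - p (j + s) x) \<longlonglongrightarrow> 0"
      by (simp add: tendsto_rabs_zero_iff)
    then have "(\<lambda>j. f x - (f x - p (j + s) x)) \<longlonglongrightarrow> f x - 0"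
      by (intro tendsto_intros)
    then have "(\<lambda>j. p (j + s) x) \<longlonglongrightarrow> f x"
      by simp
    then show ?case
      by (rule LIMSEQ_offset)
  qed
qed

section \<open>Union bound over index sets and links\<close>

text \<open>One term of the binomial expansion of \<open>(1 + m/k)\<^sup>k \<le> e\<^sup>m\<close>.\<close>

lemma binomial_le_exp:
  assumes "1 \<le> m" "m \<le> k"
  shows "real (k choose m) \<le> exp (real m * ln (exp 1 * real k / real m))"
proof -
  let ?x = "real m / real k"
  have x: "?x > 0"
    using assms by simp
  have "real (k choose m) * ?x ^ m \<le> (\<Sum>i\<le>k. real (k choose i) * ?x ^ i)"
    using assms by (intro member_le_sum) auto
  also have "\<dots> = (1 + ?x) ^ k"
    using binomial_ring[of ?x 1 k] by (simp add: add.commute)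
  also have "\<dots> \<le> exp ?x ^ k"
    using x by (intro power_mono exp_ge_add_one_self) auto
  also have "\<dots> = exp (real m)"
    using assms by (simp flip: exp_of_nat_mult)
  finally have "real (k choose m) \<le> exp (real m) / ?x ^ m"
    using x by (simp only: pos_le_divide_eq zero_less_power)
  also have "exp (real m) = exp 1 ^ m"
    by (simp flip: exp_of_nat_mult)
  also have "exp 1 ^ m / ?x ^ m = (exp 1 * real k / real m) ^ m"
    by (simp add: power_divide power_mult_distrib)
  also have "\<dots> = exp (real m * ln (exp 1 * real k / real m))"
    using assms by (simp add: exp_of_nat_mult)
  finally show ?thesis .
qed

lemma ln_ratio_ge_1:
  assumes "1 \<le> m" "m \<le> k"
  shows "1 \<le> ln (exp 1 * real k / real m)"
proof -
  have "exp 1 \<le> exp 1 * real k / real m"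
    using assms by (simp add: field_simps)
  then show ?thesis
    using assms by (subst ln_ge_iff) auto
qed

lemma index_set_bounds:
  assumes "I \<subseteq> {1..k}" "I \<noteq> {}"
  shows "finite I" and "1 \<le> card I" and "card I \<le> k"
    and "1 \<le> ln (exp 1 * real k / real (card I))"
proof -
  show fin: "finite I"
    using assms(1) by (rule finite_subset) simp
  with assms show *: "1 \<le> card I" "card I \<le> k"
    using card_mono[of "{1..k}" I] by (auto simp: Suc_le_eq card_gt_0_iff)
  show "1 \<le> ln (exp 1 * real k / real (card I))"
    by (rule ln_ratio_ge_1[OF *])
qed

text \<open>The \<open>k choose m \<le> exp (m l)\<close> sets of size \<open>m\<close> use up one unit of \<open>w\<close>; since \<open>l \<ge> 1\<close>, what remains
  is at most \<open>exp (-m)\<close>.\<close>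

lemma sum_subsets_exp_le:
  assumes w: "w \<ge> 2"
  shows "(\<Sum>I\<in>Pow {1..k} - {{}}. exp (- w * (real (card I) * ln (exp 1 * real k / real (card I))))) \<le> 1"
proof -
  define f where "f m = exp (- w * (real m * ln (exp 1 * real k / real m)))" for m
  have term_le: "real (k choose m) * f m \<le> (1 / 2) ^ m" if "m \<in> {1..k}" for m
  proof -
    define l where "l = ln (exp 1 * real k / real m)"
    have l: "1 \<le> l"
      unfolding l_def using that by (intro ln_ratio_ge_1) auto
    have "real (k choose m) * f m \<le> exp (real m * l) * exp (- w * (real m * l))"
      using binomial_le_exp[of m k] that by (auto simp: f_def l_def intro!: mult_right_mono)
    also have "\<dots> = exp (- ((w - 1) * l * real m))"
      by (simp add: algebra_simps flip: exp_add)
    also have "\<dots> \<le> exp (- (1 * 1 * real m))"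
      unfolding exp_le_cancel_iff neg_le_iff_le using w l by (intro mult_right_mono mult_mono) auto
    also have "\<dots> = (1 / exp 1) ^ m"
      by (simp add: power_one_over exp_minus inverse_eq_divide flip: exp_of_nat_mult)
    also have "\<dots> \<le> (1 / 2) ^ m"
      using exp_ge_add_one_self[of 1] by (intro power_mono divide_left_mono) auto
    finally show ?thesis .
  qed
  have half: "(\<Sum>m=1..k. (1 / 2 :: real) ^ m) \<le> 1 - (1 / 2) ^ k"
    by (induction k) auto
  have "(\<Sum>I\<in>Pow {1..k} - {{}}. f (card I)) =
      (\<Sum>m\<in>{1..k}. \<Sum>I | I \<in> Pow {1..k} - {{}} \<and> card I = m. f (card I))"
  proof (rule sum.group[symmetric])
    show "card ` (Pow {1..k} - {{}}) \<subseteq> {1..k}"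
    proof
      fix m assume "m \<in> card ` (Pow {1..k} - {{}})"
      then obtain I where I: "I \<subseteq> {1..k}" "I \<noteq> {}" "m = card I"
        by auto
      with index_set_bounds[OF I(1,2)] show "m \<in> {1..k}"
        by simp
    qed
  qed auto
  also have "\<dots> = (\<Sum>m=1..k. real (k choose m) * f m)"
  proof (rule sum.cong)
    fix m assume "m \<in> {1..k}"
    then have "{I \<in> Pow {1..k} - {{}}. card I = m} = {I. I \<subseteq> {1..k} \<and> card I = m}"
      by auto
    then show "(\<Sum>I | I \<in> Pow {1..k} - {{}} \<and> card I = m. f (card I)) = real (k choose m) * f m"
      using n_subsets[of "{1..k}" m] by simp
  qed simp
  also have "\<dots> \<le> (\<Sum>m=1..k. (1 / 2) ^ m)"
    by (intro sum_mono term_le)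
  also have "\<dots> \<le> 1"
    using half zero_le_power[of "1 / 2 :: real" k] by linarith
  finally show ?thesis
    by (simp add: f_def)
qed

lemma emeasure_UN_le_sum:
  assumes "finite I" "\<And>i. i \<in> I \<Longrightarrow> A i \<in> sets M"
    and "\<And>i. i \<in> I \<Longrightarrow> emeasure M (A i) \<le> ennreal (b i)" "\<And>i. i \<in> I \<Longrightarrow> 0 \<le> b i"
  shows "emeasure M (\<Union>i\<in>I. A i) \<le> ennreal (\<Sum>i\<in>I. b i)"
proof -
  have "emeasure M (\<Union>i\<in>I. A i) \<le> (\<Sum>i\<in>I. emeasure M (A i))"
    using assms by (intro emeasure_subadditive_finite) auto
  also have "\<dots> \<le> (\<Sum>i\<in>I. ennreal (b i))"
    using assms by (intro sum_mono) auto
  also have "\<dots> = ennreal (\<Sum>i\<in>I. b i)"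
    using assms by (intro sum_ennreal) auto
  finally show ?thesis .
qed

text \<open>The budget of a level \<open>j\<close>: three units of \<open>w\<close> pay for the pairs in \<open>A (j + 1) \<times> A j\<close>, and one unit
  for the at most \<open>j + 1\<close> sequences (one for each starting level \<open>s \<le> j\<close>).  This leaves
  \<open>(\<delta>/2)\<^bsup>2^j\<^esup>\<close>, which sums to at most \<open>\<delta>\<close>.\<close>

lemma level_union_bound:
  assumes w: "w = 4 + ln (2 / \<delta>)" and \<delta>: "0 < \<delta>" "\<delta> < 1"
    and c: "c \<le> (2 :: nat) ^ 2 ^ Suc j * 2 ^ 2 ^ j"
  shows "real (Suc j) * (real c * exp (- w * 2 ^ j)) \<le> (\<delta> / 2) ^ Suc j"
proof -
  have two: "(2::real) \<le> exp 1"
    using exp_ge_add_one_self[of 1] by simp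
  have sj: "Suc j \<le> 2 ^ j"
    by (intro Suc_leI less_exp)
  have "real c \<le> 2 ^ 2 ^ Suc j * 2 ^ 2 ^ j"
    using of_nat_mono[OF c, where 'a = real] by (simp only: of_nat_mult of_nat_power of_nat_numeral)
  also have "\<dots> = (2 :: real) ^ (3 * 2 ^ j)"
    by (simp flip: power_add)
  also have "\<dots> \<le> exp 1 ^ (3 * 2 ^ j)"
    using two by (intro power_mono) auto
  also have "\<dots> = exp (3 * 2 ^ j)"
    by (simp flip: exp_of_nat_mult)
  finally have c': "real c \<le> exp (3 * 2 ^ j)" .
  have "real (Suc j) \<le> 2 ^ j"
    using of_nat_mono[OF sj, where 'a = real] by (simp only: of_nat_power of_nat_numeral)
  also have "\<dots> \<le> exp (2 ^ j)"
    using exp_ge_add_one_self[of "2 ^ j :: real"] by linarith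
  finally have "real (Suc j) * (real c * exp (- w * 2 ^ j)) \<le> exp (2 ^ j) * (exp (3 * 2 ^ j) * exp (- w * 2 ^ j))"
    using c' by (intro mult_mono) auto
  also have "\<dots> = exp (real (2 ^ j) * ln (\<delta> / 2))"
    using \<delta> by (simp add: w ln_div algebra_simps flip: exp_add)
  also have "\<dots> = (\<delta> / 2) ^ 2 ^ j"
    using \<delta> by (subst exp_of_nat_mult) simp
  also have "\<dots> \<le> (\<delta> / 2) ^ Suc j"
    using sj \<delta> by (intro power_decreasing) auto
  finally show ?thesis .
qed

text \<open>One event serves all starting levels \<open>s\<close>, each of which comes with its own admissible sequence
  \<open>A s\<close>.  The union bound is finite at each level \<open>j\<close> because only the sequences with \<open>s \<le> j\<close> are
  considered there.\<close>

lemma uniform_increment_bound: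
  fixes X :: "nat \<Rightarrow> 'w \<Rightarrow> 'a"
  assumes "prob_space N" and indep: "prob_space.indep_vars N (\<lambda>_. M) X {1..k}"
    and distr: "\<And>i. i \<in> {1..k} \<Longrightarrow> distr N M (X i) = M"
    and sub: "subgaussian_class M L F" and L: "L > 0"
    and adm: "\<And>s. admissible_seq F (A s)"
    and \<delta>: "0 < \<delta>" "\<delta> < 1" and w: "w = 4 + ln (2 / \<delta>)"
  shows "\<exists>G\<in>sets N. measure N G \<ge> 1 - \<delta> \<and>
    (\<forall>\<omega>\<in>G. \<forall>s j I p q. s \<le> j \<longrightarrow> I \<subseteq> {1..k} \<longrightarrow> I \<noteq> {} \<longrightarrow> p \<in> A s (Suc j) \<longrightarrow> q \<in> A s j \<longrightarrow>
      (\<Sum>i\<in>I. (p (X i \<omega>) - q (X i \<omega>))\<^sup>2) \<le> 4 * L\<^sup>2 * (L2_norm M (\<lambda>x. p x - q x))\<^sup>2 *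
        (real (card I) + w * (2 ^ j + real (card I) * ln (exp 1 * real k / real (card I)))))"
proof -
  interpret N: prob_space N by fact
  define l where "l I = real (card I) * ln (exp 1 * real k / real (card I))" for I :: "nat set"
  define S where "S = Pow {1..k} - {{}}"
  define B where "B j I pq = {\<omega> \<in> space N. 4 * L\<^sup>2 * (L2_norm M (\<lambda>x. fst pq x - snd pq x))\<^sup>2 *
      (real (card I) + w * (2 ^ j + l I)) < (\<Sum>i\<in>I. (fst pq (X i \<omega>) - snd pq (X i \<omega>))\<^sup>2)}"
    for j :: nat and I and pq :: "('a \<Rightarrow> real) \<times> ('a \<Rightarrow> real)"
  define U where "U j = (\<Union>s\<le>j. \<Union>I\<in>S. \<Union>pq\<in>A s (Suc j) \<times> A s j. B j I pq)" for j
  have FL2: "F \<subseteq> L2_space M"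
    using sub by (simp add: subgaussian_class_def)
  have AF: "A s j \<subseteq> F" for s j
    using adm by (simp add: admissible_seq_def)
  have finA: "finite (A s j)" for s j
    using adm by (rule admissible_seq_finite)
  have finS: "finite S"
    by (simp add: S_def)
  have ln2: "ln (2 / \<delta>) > 0"
    using \<delta> by simp
  have l0: "l I \<ge> 0" if "I \<in> S" for I
    using index_set_bounds(4)[of I k] that by (simp add: l_def S_def)
  have B_sets: "B j I pq \<in> sets N" and
    B_le: "emeasure N (B j I pq) \<le> ennreal (exp (- (w * (2 ^ j + l I))))"
    if I: "I \<in> S" and pq: "pq \<in> A s (Suc j) \<times> A s j" for s j I pq
  proof -
    let ?h = "\<lambda>x. fst pq x - snd pq x"
    have F: "fst pq \<in> F" "snd pq \<in> F"
      using pq AF[of s j] AF[of s "Suc j"] by auto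
    then have h: "?h \<in> L2_space M"
      using FL2 by (intro L2_space_diff) auto
    have I': "I \<subseteq> {1..k}" "finite I"
      using I by (auto simp: S_def dest: finite_subset)
    have "(\<lambda>\<omega>. ?h (X i \<omega>)) \<in> borel_measurable N" if "i \<in> I" for i
      by (rule measurable_compose[of "X i" N M])
        (use indep h I' that in \<open>auto simp: N.indep_vars_def L2_space_def\<close>)
    then show "B j I pq \<in> sets N"
      unfolding B_def by measurable
    have "psi2_norm M ?h \<le> ennreal (L * L2_norm M ?h)"
      using sub F by (simp add: subgaussian_class_def)
    from subgaussian_deviation[OF \<open>prob_space N\<close> indep distr I' h L _ this] ln2 l0[OF I]
    show "emeasure N (B j I pq) \<le> ennreal (exp (- (w * (2 ^ j + l I))))"
      unfolding B_def by (simp add: w)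
  qed
  have U_sets: "U j \<in> sets N" for j
    unfolding U_def using B_sets finS finA by (intro sets.finite_UN) auto
  have U_le: "emeasure N (U j) \<le> ennreal ((\<delta> / 2) ^ Suc j)" for j
  proof -
    define c where "c = (2 :: nat) ^ 2 ^ Suc j * 2 ^ 2 ^ j"
    have inner: "emeasure N (\<Union>pq\<in>A s (Suc j) \<times> A s j. B j I pq) \<le>
        ennreal (real c * exp (- w * 2 ^ j) * exp (- w * l I))" if I: "I \<in> S" for s I
    proof -
      have "emeasure N (\<Union>pq\<in>A s (Suc j) \<times> A s j. B j I pq) \<le>
          ennreal (\<Sum>pq\<in>A s (Suc j) \<times> A s j. exp (- (w * (2 ^ j + l I))))"
        using finA B_sets[OF I] B_le[OF I] by (intro emeasure_UN_le_sum) auto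
      also have "\<dots> \<le> ennreal (real c * exp (- w * 2 ^ j) * exp (- w * l I))"
      proof (rule ennreal_leI)
        have "card (A s (Suc j) \<times> A s j) \<le> c"
          unfolding card_cartesian_product c_def
          by (intro mult_le_mono admissible_seq_card[OF adm])
        then have "real (card (A s (Suc j) \<times> A s j)) * exp (- (w * (2 ^ j + l I))) \<le>
            real c * exp (- (w * (2 ^ j + l I)))"
          by (intro mult_right_mono) auto
        moreover have "exp (- (w * (2 ^ j + l I))) = exp (- w * 2 ^ j) * exp (- w * l I)"
          by (simp add: algebra_simps flip: exp_add)
        ultimately show "(\<Sum>pq\<in>A s (Suc j) \<times> A s j. exp (- (w * (2 ^ j + l I)))) \<le>
            real c * exp (- w * 2 ^ j) * exp (- w * l I)"
          unfolding sum_constant by (simp only: mult.assoc)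
      qed
      finally show ?thesis .
    qed
    have "emeasure N (\<Union>I\<in>S. \<Union>pq\<in>A s (Suc j) \<times> A s j. B j I pq) \<le>
        ennreal (real c * exp (- w * 2 ^ j))" for s
    proof -
      have "emeasure N (\<Union>I\<in>S. \<Union>pq\<in>A s (Suc j) \<times> A s j. B j I pq) \<le>
          ennreal (\<Sum>I\<in>S. real c * exp (- w * 2 ^ j) * exp (- w * l I))"
        using finS finA B_sets inner by (intro emeasure_UN_le_sum sets.finite_UN) auto
      also have "\<dots> \<le> ennreal (real c * exp (- w * 2 ^ j))"
      proof (rule ennreal_leI)
        have "(\<Sum>I\<in>S. exp (- w * l I)) \<le> 1"
          unfolding S_def l_def using ln2 by (intro sum_subsets_exp_le) (simp add: w)
        then have "real c * exp (- w * 2 ^ j) * (\<Sum>I\<in>S. exp (- w * l I)) \<le> real c * exp (- w * 2 ^ j) * 1"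
          by (intro mult_left_mono) auto
        then show "(\<Sum>I\<in>S. real c * exp (- w * 2 ^ j) * exp (- w * l I)) \<le> real c * exp (- w * 2 ^ j)"
          by (simp only: sum_distrib_left mult_1_right)
      qed
      finally show ?thesis .
    qed
    then have "emeasure N (U j) \<le> ennreal (\<Sum>s\<le>j. real c * exp (- w * 2 ^ j))"
      unfolding U_def using finS finA B_sets by (intro emeasure_UN_le_sum sets.finite_UN) auto
    also have "\<dots> \<le> ennreal ((\<delta> / 2) ^ Suc j)"
    proof (rule ennreal_leI)
      have "(\<Sum>s\<le>j. real c * exp (- w * 2 ^ j)) = real (Suc j) * (real c * exp (- w * 2 ^ j))"
        by simp
      also have "\<dots> \<le> (\<delta> / 2) ^ Suc j"
        by (rule level_union_bound[OF w \<delta>]) (simp add: c_def)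
      finally show "(\<Sum>s\<le>j. real c * exp (- w * 2 ^ j)) \<le> (\<delta> / 2) ^ Suc j" .
    qed
    finally show ?thesis .
  qed
  define G where "G = space N - (\<Union>j. U j)"
  have "emeasure N (\<Union>j. U j) \<le> (\<Sum>j. emeasure N (U j))"
    using U_sets by (intro emeasure_subadditive_countably) auto
  also have "\<dots> \<le> (\<Sum>j. ennreal ((\<delta> / 2) ^ Suc j))"
    by (intro suminf_le U_le) auto
  also have "\<dots> = ennreal (\<delta> / 2 * (1 / (1 - \<delta> / 2)))"
    unfolding power_Suc using \<delta> by (intro suminf_ennreal_eq sums_mult geometric_sums) auto
  also have "\<dots> \<le> ennreal \<delta>"
    using \<delta> by (intro ennreal_leI) (simp add: field_simps)
  finally have "measure N (\<Union>j. U j) \<le> \<delta>"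
    using \<delta> by (simp add: N.emeasure_eq_measure)
  moreover have UU: "(\<Union>j. U j) \<in> sets N"
    using U_sets by auto
  ultimately have "measure N G \<ge> 1 - \<delta>"
    unfolding G_def by (simp add: N.prob_compl)
  moreover have "G \<in> sets N"
    unfolding G_def using UU by auto
  moreover have "(\<Sum>i\<in>I. (p (X i \<omega>) - q (X i \<omega>))\<^sup>2) \<le> 4 * L\<^sup>2 * (L2_norm M (\<lambda>x. p x - q x))\<^sup>2 *
        (real (card I) + w * (2 ^ j + real (card I) * ln (exp 1 * real k / real (card I))))"
    if "\<omega> \<in> G" "s \<le> j" "I \<subseteq> {1..k}" "I \<noteq> {}" "p \<in> A s (Suc j)" "q \<in> A s j" for \<omega> s j I p q
  proof -
    have "\<omega> \<in> space N" "\<omega> \<notin> U j"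
      using that(1) by (auto simp: G_def)
    moreover have "I \<in> S" "(p, q) \<in> A s (Suc j) \<times> A s j"
      using that by (auto simp: S_def)
    ultimately have "\<omega> \<notin> B j I (p, q)"
      using \<open>s \<le> j\<close> unfolding U_def by blast
    with \<open>\<omega> \<in> space N\<close> show ?thesis
      by (simp add: B_def l_def not_less)
  qed
  ultimately show ?thesis
    by (intro bexI[of _ G]) auto
qed

section \<open>From controlled links to the empirical functional\<close>

lemma emp_norm_tendsto_0:
  assumes "\<And>i. i \<in> I \<Longrightarrow> (\<lambda>n. h n (x i)) \<longlonglongrightarrow> 0"
  shows "(\<lambda>n. emp_norm x I (h n)) \<longlonglongrightarrow> 0"
proof -
  have "(\<lambda>n. sqrt ((\<Sum>i\<in>I. (h n (x i))\<^sup>2) / real (card I))) \<longlonglongrightarrow>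
      sqrt ((\<Sum>i\<in>I. 0\<^sup>2) * inverse (real (card I)))"
    unfolding divide_inverse by (intro tendsto_intros assms)
  then show ?thesis
    by (simp add: emp_norm_def)
qed

text \<open>The comparison of empirical and \<open>L\<^sub>2\<close> norms on both sides of the critical level \<open>u\<close>, where
  \<open>2\<^sup>u \<approx> m l\<close>.  Below it the deviation \<open>2\<^sup>j + m l\<close> is of order \<open>m l\<close>; above it the deviation is of
  order \<open>2\<^sup>j\<close>, and the surplus over \<open>m l\<close> is compensated by the smaller weight \<open>2\<^bsup>u/2\<^esup>\<close> on the left.\<close>

lemma weighted_increment_le:
  assumes m: "m = real (card I)" "m > 0" and l: "l \<ge> 1"
    and u: "m * l \<le> 2 ^ u" "2 ^ u \<le> 2 * (m * l)"
    and w: "w \<ge> 0" and L: "L > 0" and a: "a \<ge> 0"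
    and le: "(\<Sum>i\<in>I. (h (x i))\<^sup>2) \<le> 4 * L\<^sup>2 * a\<^sup>2 * (m + w * (2 ^ j + m * l))"
  shows "sqrt 2 ^ min j u * emp_norm x I h \<le> 4 * L * sqrt (w + 1) * sqrt l * (sqrt 2 ^ j * a)"
proof (rule power2_le_imp_le)
  have cases: "2 ^ min j u * (2 ^ j + m * l) \<le> 4 * 2 ^ j * (m * l)"
  proof (cases "j \<le> u")
    case True
    then have "(2::real) ^ j \<le> 2 ^ u"
      by (intro power_increasing) auto
    then have "2 ^ j + m * l \<le> 4 * (m * l)"
      using u m l by (smt (verit) mult_nonneg_nonneg)
    then have "2 ^ j * (2 ^ j + m * l) \<le> 2 ^ j * (4 * (m * l))"
      by (intro mult_left_mono) auto
    with True show ?thesis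
      by (simp add: min_def mult_ac)
  next
    case False
    then have "(2::real) ^ u \<le> 2 ^ j"
      by (intro power_increasing) auto
    then have "m * l \<le> 2 ^ j"
      using u by linarith
    then have "2 ^ u * (2 ^ j + m * l) \<le> 2 * (m * l) * (2 ^ j + 2 ^ j)"
      using u m l by (intro mult_mono add_mono) auto
    with False show ?thesis
      by (simp add: min_def mult_ac)
  qed
  have "m \<le> 2 ^ j + m * l"
    using m l by (smt (verit) mult_le_cancel_left1 zero_less_power)
  then have "m + w * (2 ^ j + m * l) \<le> (w + 1) * (2 ^ j + m * l)"
    by (simp add: algebra_simps)
  then have "4 * L\<^sup>2 * a\<^sup>2 * (m + w * (2 ^ j + m * l)) \<le> 4 * L\<^sup>2 * a\<^sup>2 * ((w + 1) * (2 ^ j + m * l))"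
    by (intro mult_left_mono) auto
  with le have sum: "(\<Sum>i\<in>I. (h (x i))\<^sup>2) \<le> 4 * L\<^sup>2 * a\<^sup>2 * ((w + 1) * (2 ^ j + m * l))"
    by simp
  have "(sqrt 2 ^ min j u * emp_norm x I h)\<^sup>2 = 2 ^ min j u * ((\<Sum>i\<in>I. (h (x i))\<^sup>2) / m)"
    by (simp add: power_mult_distrib sqrt2_power_power2 emp_norm_def m(1) sum_nonneg)
  also have "\<dots> \<le> 2 ^ min j u * (4 * L\<^sup>2 * a\<^sup>2 * ((w + 1) * (2 ^ j + m * l)) / m)"
    using sum m by (intro mult_left_mono divide_right_mono) auto
  also have "\<dots> = 4 * L\<^sup>2 * a\<^sup>2 * (w + 1) / m * (2 ^ min j u * (2 ^ j + m * l))"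
    by simp
  also have "\<dots> \<le> 4 * L\<^sup>2 * a\<^sup>2 * (w + 1) / m * (4 * 2 ^ j * (m * l))"
    using m w by (intro mult_left_mono cases) auto
  also have "\<dots> = 16 * L\<^sup>2 * (w + 1) * l * (2 ^ j * a\<^sup>2)"
    using m by (simp add: field_simps)
  also have "\<dots> = (4 * L * sqrt (w + 1) * sqrt l * (sqrt 2 ^ j * a))\<^sup>2"
    using w l by (simp add: power_mult_distrib sqrt2_power_power2)
  finally show "(sqrt 2 ^ min j u * emp_norm x I h)\<^sup>2 \<le>
      (4 * L * sqrt (w + 1) * sqrt l * (sqrt 2 ^ j * a))\<^sup>2" .
  show "0 \<le> 4 * L * sqrt (w + 1) * sqrt l * (sqrt 2 ^ j * a)"
    using L w l a by simp
qed

lemma dyadic_ceiling: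
  fixes b :: real
  assumes "2 ^ s \<le> b"
  obtains u where "s \<le> u" "b \<le> 2 ^ u" "2 ^ u \<le> 2 * b"
proof -
  define u where "u = (LEAST n. b \<le> 2 ^ n)"
  have "\<exists>n. b \<le> 2 ^ n"
    using real_arch_pow[of 2 b] by (auto intro: less_imp_le)
  then have u: "b \<le> 2 ^ u"
    unfolding u_def by (rule LeastI_ex)
  have "(2::real) ^ s \<le> 2 ^ u"
    using assms u by linarith
  then have "s \<le> u"
    by simp
  moreover have "2 ^ u \<le> 2 * b"
  proof (cases u)
    case 0
    have "(1::real) \<le> 2 ^ s"
      by simp
    with assms have "1 \<le> b"
      by linarith
    with 0 show ?thesis
      by simp
  next
    case (Suc v)
    then have "\<not> b \<le> 2 ^ v"
      using not_less_Least[of v "\<lambda>n. b \<le> 2 ^ n"] by (simp add: u_def)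
    with Suc show ?thesis
      by simp
  qed
  ultimately show ?thesis
    using u that by blast
qed

text \<open>The deterministic part of the argument, for a fixed sample and a fixed index set.  The constant is
  \<open>1344 = 21 \<sqdot> 4 \<sqdot> 4 \<sqdot> 4\<close>: refinement above the level \<open>u\<close>, exchange of summations, passage from
  distances to links (twice the factor \<open>2\<close> of the quasi-triangle inequality), and comparison of the
  norms.\<close>

lemma gamma2_emp_norm_le_of_increments:
  fixes x :: "nat \<Rightarrow> 'a"
  assumes FL2: "F \<subseteq> L2_space M" and adm: "admissible_seq F A"
    and I: "finite I" "I \<noteq> {}" and D: "D \<subseteq> F"
    and dense: "\<And>f. f \<in> F \<Longrightarrow>
      \<exists>g. (\<forall>n. g n \<in> D) \<and> (\<forall>i\<in>I. (\<lambda>n. g n (x i)) \<longlonglongrightarrow> f (x i))"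
    and p_mem: "\<And>f j. f \<in> D \<Longrightarrow> s \<le> j \<Longrightarrow> p f j \<in> A j"
    and p_sum: "\<And>f n. f \<in> D \<Longrightarrow> (\<Sum>j=s..<n. sqrt 2 ^ j * L2_norm M (\<lambda>y. f y - p f j y)) \<le> G"
    and p_lim: "\<And>f i. f \<in> D \<Longrightarrow> i \<in> I \<Longrightarrow> (\<lambda>j. p f j (x i)) \<longlonglongrightarrow> f (x i)"
    and incr: "\<And>j f g. s \<le> j \<Longrightarrow> f \<in> A (Suc j) \<Longrightarrow> g \<in> A j \<Longrightarrow>
      (\<Sum>i\<in>I. (f (x i) - g (x i))\<^sup>2) \<le> 4 * L\<^sup>2 * (L2_norm M (\<lambda>y. f y - g y))\<^sup>2 *
        (real (card I) + w * (2 ^ j + real (card I) * l))"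
    and l: "l \<ge> 1" and s: "2 ^ s \<le> real (card I) * l" and w: "w \<ge> 0" and G: "G > 0" and L: "L > 0"
  shows "gamma2_norm (s + 1) F (emp_norm x I) \<le> ennreal (1344 * sqrt (w + 1) * L * sqrt l * G)"
proof -
  define K where "K = 4 * L * sqrt (w + 1) * sqrt l"
  have K: "K > 0"
    using L w l by (simp add: K_def)
  let ?d = "\<lambda>f g. emp_norm x I (\<lambda>y. f y - g y)"
  let ?a = "\<lambda>f j. L2_norm M (\<lambda>y. f y - p f j y)"
  obtain u where u: "s \<le> u" "real (card I) * l \<le> 2 ^ u" "2 ^ u \<le> 2 * (real (card I) * l)"
    using dyadic_ceiling[OF s] .
  have m: "real (card I) > 0"
    using I by (simp add: card_gt_0_iff)
  have card: "card I \<le> 2 ^ u"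
  proof -
    have "real (card I) \<le> real (card I) * l"
      using m l by simp
    with u(2) have "real (card I) \<le> 2 ^ u"
      by linarith
    then have "real (card I) \<le> real (2 ^ u)"
      by (simp only: of_nat_power of_nat_numeral)
    then show ?thesis
      unfolding of_nat_le_iff .
  qed
  have step: "sqrt 2 ^ min j u * ?d (p f (Suc j)) (p f j) \<le>
      2 * K * (sqrt 2 ^ Suc j * ?a f (Suc j) + sqrt 2 ^ j * ?a f j)" if f: "f \<in> D" and j: "s \<le> j" for f j
  proof -
    have mem: "p f (Suc j) \<in> A (Suc j)" "p f j \<in> A j"
      using p_mem f j by auto
    have "A i \<subseteq> F" for i
      using adm by (simp add: admissible_seq_def)
    then have L2: "f \<in> L2_space M" "p f (Suc j) \<in> L2_space M" "p f j \<in> L2_space M"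
      using mem f D FL2 by blast+
    have "sqrt 2 ^ min j u * ?d (p f (Suc j)) (p f j) \<le>
        K * (sqrt 2 ^ j * L2_norm M (\<lambda>y. p f (Suc j) y - p f j y))"
      unfolding K_def using incr[OF j mem] m l u w L
      by (intro weighted_increment_le[where m = "real (card I)"]) auto
    also have "\<dots> \<le> K * (sqrt 2 ^ j * (2 * (?a f (Suc j) + ?a f j)))"
      using K L2 by (intro mult_left_mono L2_norm_quasi_triangle) auto
    also have "\<dots> = 2 * K * (sqrt 2 ^ j * ?a f (Suc j) + sqrt 2 ^ j * ?a f j)"
      by (simp add: algebra_simps)
    also have "\<dots> \<le> 2 * K * (sqrt 2 ^ Suc j * ?a f (Suc j) + sqrt 2 ^ j * ?a f j)"
      using K by (intro mult_left_mono add_mono mult_right_mono power_increasing) auto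
    finally show ?thesis .
  qed
  have total: "(\<Sum>j=s..<n. sqrt 2 ^ min j u * ?d (p f (Suc j)) (p f j)) \<le> 4 * K * G"
    if f: "f \<in> D" for f n
  proof -
    have "(\<Sum>j=s..<n. sqrt 2 ^ min j u * ?d (p f (Suc j)) (p f j)) \<le>
        (\<Sum>j=s..<n. 2 * K * (sqrt 2 ^ Suc j * ?a f (Suc j) + sqrt 2 ^ j * ?a f j))"
      by (intro sum_mono step f) auto
    also have "\<dots> = 2 * K * ((\<Sum>j=s..<n. sqrt 2 ^ Suc j * ?a f (Suc j)) + (\<Sum>j=s..<n. sqrt 2 ^ j * ?a f j))"
      by (simp only: sum_distrib_left [symmetric] sum.distrib)
    also have "(\<Sum>j=s..<n. sqrt 2 ^ Suc j * ?a f (Suc j)) = (\<Sum>j=Suc s..<Suc n. sqrt 2 ^ j * ?a f j)"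
      by (rule sum.shift_bounds_Suc_ivl[symmetric])
    also have "2 * K * ((\<Sum>j=Suc s..<Suc n. sqrt 2 ^ j * ?a f j) + (\<Sum>j=s..<n. sqrt 2 ^ j * ?a f j)) \<le>
        2 * K * (G + G)"
    proof (intro mult_left_mono add_mono p_sum f)
      have "(\<Sum>j=Suc s..<Suc n. sqrt 2 ^ j * ?a f j) \<le> (\<Sum>j=s..<Suc n. sqrt 2 ^ j * ?a f j)"
        by (intro sum_mono2) auto
      also have "\<dots> \<le> G"
        by (rule p_sum[OF f])
      finally show "(\<Sum>j=Suc s..<Suc n. sqrt 2 ^ j * ?a f j) \<le> G" .
    qed (use K in auto)
    finally show ?thesis
      by simp
  qed
  have "gamma2 (s + 1) F ?d \<le> ennreal (21 * (4 * (4 * K * G)))"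
  proof (rule gamma2_emp_norm_le[OF adm I(1) card _ u(1) _ D])
    fix f assume f: "f \<in> D"
    have "(\<Sum>j=s..u. sqrt 2 ^ j * ?d f (p f j)) \<le> 4 * (4 * K * G)"
    proof (rule chain_sum_le[where d = ?d])
      show "(\<lambda>n. ?d f (p f n)) \<longlonglongrightarrow> 0"
      proof (rule emp_norm_tendsto_0)
        fix i assume "i \<in> I"
        then have "(\<lambda>n. f (x i) - p f n (x i)) \<longlonglongrightarrow> f (x i) - f (x i)"
          by (intro tendsto_intros p_lim f)
        then show "(\<lambda>n. f (x i) - p f n (x i)) \<longlonglongrightarrow> 0"
          by simp
      qed
    qed (use emp_norm_triangle total[OF f] in auto)
    with p_mem[OF f]
    show "\<exists>p. (\<forall>j\<in>{s..u}. p j \<in> A j) \<and> (\<Sum>j=s..u. sqrt 2 ^ j * ?d f (p j)) \<le> 4 * (4 * K * G)"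
      by (intro exI[of _ "p f"]) auto
  next
    fix t and \<epsilon> :: real assume t: "t \<in> F" "0 < \<epsilon>"
    then obtain g where g: "\<And>n. g n \<in> D" "\<And>i. i \<in> I \<Longrightarrow> (\<lambda>n. g n (x i)) \<longlonglongrightarrow> t (x i)"
      using dense by blast
    have "(\<lambda>n. ?d t (g n)) \<longlonglongrightarrow> 0"
    proof (rule emp_norm_tendsto_0)
      fix i assume "i \<in> I"
      then have "(\<lambda>n. t (x i) - g n (x i)) \<longlonglongrightarrow> t (x i) - t (x i)"
        by (intro tendsto_intros g)
      then show "(\<lambda>n. t (x i) - g n (x i)) \<longlonglongrightarrow> 0"
        by simp
    qed
    then have "eventually (\<lambda>n. ?d t (g n) < \<epsilon>) sequentially"
      using t(2) by (rule order_tendstoD)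
    then obtain n where "?d t (g n) < \<epsilon>"
      by (auto simp: eventually_sequentially)
    with g(1) show "\<exists>f\<in>D. ?d t f < \<epsilon>"
      by blast
  qed (use K G in auto)
  then show ?thesis
    by (simp add: gamma2_norm_def K_def mult_ac)
qed

section \<open>Nearly optimal sequences and the exceptional event\<close>

lemma (in prob_space) prob_limsup_ge:
  fixes G :: "nat \<Rightarrow> 'a set"
  assumes G: "\<And>n. G n \<in> sets M" and c: "\<And>n. c \<le> prob (G n)"
  shows "(\<Inter>m. \<Union>n\<in>{m..}. G n) \<in> sets M" and "c \<le> prob (\<Inter>m. \<Union>n\<in>{m..}. G n)"
proof -
  have U: "(\<Union>n\<in>{m..}. G n) \<in> sets M" for m
    by (rule sets.countable_UN'') (use G in auto)
  then show "(\<Inter>m. \<Union>n\<in>{m..}. G n) \<in> sets M"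
    by (intro sets.countable_INT) auto
  have "(\<lambda>m. prob (\<Union>n\<in>{m..}. G n)) \<longlonglongrightarrow> prob (\<Inter>m. \<Union>n\<in>{m..}. G n)"
    using U by (intro Lim_measure_decseq) (auto simp: decseq_def intro: order_trans)
  moreover have "c \<le> prob (\<Union>n\<in>{m..}. G n)" for m
  proof -
    have "prob (G m) \<le> prob (\<Union>n\<in>{m..}. G n)"
      using U by (intro finite_measure_mono) auto
    with c[of m] show ?thesis
      by simp
  qed
  ultimately show "c \<le> prob (\<Inter>m. \<Union>n\<in>{m..}. G n)"
    by (intro LIMSEQ_le_const) auto
qed

text \<open>An admissible sequence is provided even if the functional is infinite, since the union bound ranges
  over all starting levels.\<close>

lemma near_optimal_admissible_seq:
  assumes F: "F \<noteq> {}" and \<epsilon>: "\<epsilon> > 0"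
  shows "\<exists>A. admissible_seq F A \<and> (gamma2 s F d < \<top> \<longrightarrow>
    (\<forall>t\<in>F. (\<Sum>j. ennreal (2 powr (real (j + s) / 2)) * set_dist d t (A (j + s)))
      \<le> ennreal (enn2real (gamma2 s F d) + \<epsilon>)))"
proof (cases "gamma2 s F d < \<top>")
  case True
  then have "gamma2 s F d = ennreal (enn2real (gamma2 s F d))"
    by simp
  also have "\<dots> < ennreal (enn2real (gamma2 s F d) + \<epsilon>)"
    using \<epsilon> by (subst ennreal_less_iff) auto
  finally obtain A where A: "admissible_seq F A"
      "(SUP t\<in>F. \<Sum>j. ennreal (2 powr (real (j + s) / 2)) * set_dist d t (A (j + s)))
        < ennreal (enn2real (gamma2 s F d) + \<epsilon>)"
    by (subst (asm) gamma2_def) (auto simp: INF_less_iff)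
  have "(\<Sum>j. ennreal (2 powr (real (j + s) / 2)) * set_dist d t (A (j + s)))
      \<le> ennreal (enn2real (gamma2 s F d) + \<epsilon>)" if "t \<in> F" for t
    using that by (rule order_trans[OF SUP_upper less_imp_le[OF A(2)]])
  with A(1) show ?thesis
    by (intro exI[of _ A] conjI impI ballI)
next
  case False
  from F obtain f where "f \<in> F"
    by blast
  then have "admissible_seq F (\<lambda>_. {f})"
    by (auto simp: admissible_seq_def)
  with False show ?thesis
    by blast
qed

text \<open>The event depends on the near-optimality \<open>1 / (n + 1)\<close> of the sequences, and these events need not
  be nested.  On their upper limit the bound holds for infinitely many \<open>n\<close>, so the error disappears.
  This includes the case that \<open>\<gamma>\<^sub>2\<close> is zero, where no multiplicative loss would help.\<close>

lemma emp_gamma2_bound_whp: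
  fixes M :: "'a measure" and N :: "'w measure" and X :: "nat \<Rightarrow> 'w \<Rightarrow> 'a"
  assumes "prob_space N" and L: "0 < L" and sub: "subgaussian_class M L F"
    and sep: "separable_class M F" and F: "F \<noteq> {}"
    and indep: "prob_space.indep_vars N (\<lambda>_. M) X {1..k}"
    and distr: "\<And>i. i \<in> {1..k} \<Longrightarrow> distr N M (X i) = M"
    and \<delta>: "0 < \<delta>" "\<delta> < 1" and w: "w = 4 + ln (2 / \<delta>)"
  shows "\<exists>E\<in>sets N. measure N E \<ge> 1 - \<delta> \<and>
    (\<forall>\<omega>\<in>E. \<forall>I s. I \<subseteq> {1..k} \<longrightarrow> I \<noteq> {} \<longrightarrow>
      2 ^ s \<le> real (card I) * ln (exp 1 * real k / real (card I)) \<longrightarrow>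
      gamma2_norm s F (L2_norm M) < \<top> \<longrightarrow>
      gamma2_norm (s + 1) F (emp_norm (\<lambda>i. X i \<omega>) I)
        \<le> ennreal (1344 * sqrt (w + 1) * L * sqrt (ln (exp 1 * real k / real (card I))) *
            enn2real (gamma2_norm s F (L2_norm M))))"
proof -
  interpret N: prob_space N by fact
  have FL2: "F \<subseteq> L2_space M"
    using sub by (simp add: subgaussian_class_def)
  have w0: "w \<ge> 0"
    using \<delta> by (simp add: w)
  define d where "d f g = L2_norm M (\<lambda>x. f x - g x)" for f g
  define \<gamma> where "\<gamma> s = gamma2_norm s F (L2_norm M)" for s
  have \<gamma>: "\<gamma> s = gamma2 s F d" for s
    by (simp add: \<gamma>_def gamma2_norm_def d_def[abs_def])
  define r where "r n s = enn2real (\<gamma> s) + 1 / real (Suc n)" for n s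
  have r: "r n s > 0" for n s
    by (simp add: r_def add_nonneg_pos)
  have "\<forall>n s. \<exists>A. admissible_seq F A \<and> (\<gamma> s < \<top> \<longrightarrow>
      (\<forall>t\<in>F. (\<Sum>j. ennreal (2 powr (real (j + s) / 2)) * set_dist d t (A (j + s))) \<le> ennreal (r n s)))"
    unfolding \<gamma> r_def by (rule allI, rule allI, rule near_optimal_admissible_seq[OF F]) simp
  then obtain A where A: "\<forall>n s. admissible_seq F (A n s) \<and> (\<gamma> s < \<top> \<longrightarrow>
      (\<forall>t\<in>F. (\<Sum>j. ennreal (2 powr (real (j + s) / 2)) * set_dist d t (A n s (j + s))) \<le> ennreal (r n s)))"
    unfolding choice_iff ..
  then have adm: "\<And>n s. admissible_seq F (A n s)"
    and opt: "\<And>n s t. \<gamma> s < \<top> \<Longrightarrow> t \<in> F \<Longrightarrow>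
      (\<Sum>j. ennreal (2 powr (real (j + s) / 2)) * set_dist d t (A n s (j + s))) \<le> ennreal (r n s)"
    by blast+
  have "\<forall>n s f. \<exists>p. \<gamma> s < \<top> \<longrightarrow> f \<in> F \<longrightarrow>
      (\<forall>j\<ge>s. p j \<in> A n s j) \<and> (\<forall>m. (\<Sum>j=s..<m. sqrt 2 ^ j * d f (p j)) \<le> r n s)"
  proof (intro allI)
    fix n s f
    show "\<exists>p. \<gamma> s < \<top> \<longrightarrow> f \<in> F \<longrightarrow>
      (\<forall>j\<ge>s. p j \<in> A n s j) \<and> (\<forall>m. (\<Sum>j=s..<m. sqrt 2 ^ j * d f (p j)) \<le> r n s)"
    proof (cases "\<gamma> s < \<top> \<and> f \<in> F")
      case True
      then have "\<exists>p. (\<forall>j\<ge>s. p j \<in> A n s j) \<and> (\<forall>m. (\<Sum>j=s..<m. sqrt 2 ^ j * d f (p j)) \<le> r n s)"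
        using r[of n s] by (intro nearest_points[OF adm] opt) (auto simp: d_def)
      then show ?thesis
        by blast
    qed auto
  qed
  then obtain p where p: "\<forall>n s f. \<gamma> s < \<top> \<longrightarrow> f \<in> F \<longrightarrow>
      (\<forall>j\<ge>s. p n s f j \<in> A n s j) \<and> (\<forall>m. (\<Sum>j=s..<m. sqrt 2 ^ j * d f (p n s f j)) \<le> r n s)"
    unfolding choice_iff ..
  then have p_mem: "\<And>n s f j. \<gamma> s < \<top> \<Longrightarrow> f \<in> F \<Longrightarrow> s \<le> j \<Longrightarrow> p n s f j \<in> A n s j"
    and p_sum: "\<And>n s f m. \<gamma> s < \<top> \<Longrightarrow> f \<in> F \<Longrightarrow>
      (\<Sum>j=s..<m. sqrt 2 ^ j * d f (p n s f j)) \<le> r n s"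
    by blast+
  obtain D Z where D: "D \<subseteq> F" "countable D" and Z: "Z \<in> null_sets M"
    and dense: "\<And>f. f \<in> F \<Longrightarrow> \<exists>g. (\<forall>n::nat. g n \<in> D) \<and> (\<forall>x\<in>space M - Z. (\<lambda>n. g n x) \<longlonglongrightarrow> f x)"
    using sep unfolding separable_class_def by blast
  have "AE x in M. \<forall>n s. \<forall>f\<in>D. \<gamma> s < \<top> \<longrightarrow> (\<lambda>j. p n s f j x) \<longlonglongrightarrow> f x"
    unfolding AE_all_countable AE_ball_countable[OF D(2)]
  proof (intro allI ballI)
    fix n s f assume f: "f \<in> D"
    show "AE x in M. \<gamma> s < \<top> \<longrightarrow> (\<lambda>j. p n s f j x) \<longlonglongrightarrow> f x"
    proof (cases "\<gamma> s < \<top>")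
      case True
      have "AE x in M. (\<lambda>j. p n s f j x) \<longlonglongrightarrow> f x"
      proof (rule AE_chain_converges)
        show "f \<in> L2_space M"
          using f D FL2 by blast
        show "p n s f j \<in> L2_space M" if "j \<ge> s" for j
        proof -
          have "p n s f j \<in> A n s j"
            using p_mem[OF True _ that] f D by blast
          moreover have "A n s j \<subseteq> F"
            using adm[of n s] by (simp add: admissible_seq_def)
          ultimately show ?thesis
            using FL2 by blast
        qed
        show "(\<Sum>j=s..<m. sqrt 2 ^ j * L2_norm M (\<lambda>x. f x - p n s f j x)) \<le> r n s" for m
          using p_sum[OF True, of f n m] f D by (auto simp: d_def)
      qed
      then show ?thesis
        by eventually_elim simp
    qed simp
  qed
  with AE_not_in[OF Z] AE_space[of M]
  have AE_M: "AE x in M. x \<in> space M - Z \<and> (\<forall>n s. \<forall>f\<in>D. \<gamma> s < \<top> \<longrightarrow> (\<lambda>j. p n s f j x) \<longlonglongrightarrow> f x)"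
    (is "AE x in M. ?good x")
    by eventually_elim blast
  have "AE \<omega> in N. ?good (X i \<omega>)" if i: "i \<in> {1..k}" for i
  proof (rule AE_distrD[where f = "X i" and P = ?good])
    show "X i \<in> measurable N M"
      using indep i by (auto simp: N.indep_vars_def)
    show "AE x in distr N M (X i). ?good x"
      unfolding distr[OF i] by (rule AE_M)
  qed
  then have "AE \<omega> in N. \<forall>i\<in>{1..k}. ?good (X i \<omega>)"
    by (intro AE_finite_allI) auto
  then obtain Y where Y: "Y \<in> null_sets N" "\<And>\<omega> i. \<omega> \<in> space N - Y \<Longrightarrow> i \<in> {1..k} \<Longrightarrow> ?good (X i \<omega>)"
    by (elim AE_E3) blast
  have "\<forall>n. \<exists>G\<in>sets N. measure N G \<ge> 1 - \<delta> \<and>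
    (\<forall>\<omega>\<in>G. \<forall>s j I f g. s \<le> j \<longrightarrow> I \<subseteq> {1..k} \<longrightarrow> I \<noteq> {} \<longrightarrow> f \<in> A n s (Suc j) \<longrightarrow> g \<in> A n s j \<longrightarrow>
      (\<Sum>i\<in>I. (f (X i \<omega>) - g (X i \<omega>))\<^sup>2) \<le> 4 * L\<^sup>2 * (L2_norm M (\<lambda>x. f x - g x))\<^sup>2 *
        (real (card I) + w * (2 ^ j + real (card I) * ln (exp 1 * real k / real (card I)))))"
    by (intro allI uniform_increment_bound[OF \<open>prob_space N\<close> indep distr sub L adm \<delta> w])
  then obtain G where "\<forall>n. G n \<in> sets N \<and> measure N (G n) \<ge> 1 - \<delta> \<and>
    (\<forall>\<omega>\<in>G n. \<forall>s j I f g. s \<le> j \<longrightarrow> I \<subseteq> {1..k} \<longrightarrow> I \<noteq> {} \<longrightarrow> f \<in> A n s (Suc j) \<longrightarrow> g \<in> A n s j \<longrightarrow>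
      (\<Sum>i\<in>I. (f (X i \<omega>) - g (X i \<omega>))\<^sup>2) \<le> 4 * L\<^sup>2 * (L2_norm M (\<lambda>x. f x - g x))\<^sup>2 *
        (real (card I) + w * (2 ^ j + real (card I) * ln (exp 1 * real k / real (card I)))))"
    unfolding Bex_def choice_iff ..
  then have G: "\<And>n. G n \<in> sets N" "\<And>n. measure N (G n) \<ge> 1 - \<delta>"
    and incr: "\<And>n \<omega> s j I f g. \<omega> \<in> G n \<Longrightarrow> s \<le> j \<Longrightarrow> I \<subseteq> {1..k} \<Longrightarrow> I \<noteq> {} \<Longrightarrow>
      f \<in> A n s (Suc j) \<Longrightarrow> g \<in> A n s j \<Longrightarrow>
      (\<Sum>i\<in>I. (f (X i \<omega>) - g (X i \<omega>))\<^sup>2) \<le> 4 * L\<^sup>2 * (L2_norm M (\<lambda>x. f x - g x))\<^sup>2 *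
        (real (card I) + w * (2 ^ j + real (card I) * ln (exp 1 * real k / real (card I))))"
    by blast+
  define E0 where "E0 = (\<Inter>m. \<Union>n\<in>{m..}. G n)"
  define E where "E = E0 - Y"
  have E0: "E0 \<in> sets N" "1 - \<delta> \<le> measure N E0"
    unfolding E0_def using N.prob_limsup_ge[OF G] by auto
  have "E \<in> sets N"
    using E0 Y by (auto simp: E_def)
  moreover have "measure N E = measure N E0"
    unfolding E_def using E0 Y by (intro measure_Diff_null_set) auto
  moreover have "gamma2_norm (s + 1) F (emp_norm (\<lambda>i. X i \<omega>) I)
      \<le> ennreal (1344 * sqrt (w + 1) * L * sqrt (ln (exp 1 * real k / real (card I))) * enn2real (\<gamma> s))"
    if \<omega>: "\<omega> \<in> E" and I: "I \<subseteq> {1..k}" "I \<noteq> {}"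
      and s: "2 ^ s \<le> real (card I) * ln (exp 1 * real k / real (card I))"
      and fin: "\<gamma> s < \<top>" for \<omega> I s
  proof -
    define l where "l = ln (exp 1 * real k / real (card I))"
    define K where "K = 1344 * sqrt (w + 1) * L * sqrt l"
    have finI: "finite I" and l: "l \<ge> 1"
      using index_set_bounds[OF I] by (simp_all add: l_def)
    have K: "K \<ge> 0"
      using w0 L l by (simp add: K_def)
    have "\<omega> \<in> space N - Y"
      using \<omega> E0(1) sets.sets_into_space by (auto simp: E_def)
    then have good: "?good (X i \<omega>)" if "i \<in> I" for i
      using Y(2) that I by blast
    have bound: "gamma2_norm (s + 1) F (emp_norm (\<lambda>i. X i \<omega>) I) \<le> ennreal (K * r n s)"
      if n: "\<omega> \<in> G n" for n
      unfolding K_def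
    proof (rule gamma2_emp_norm_le_of_increments[OF FL2 adm[of n s] finI I(2) D(1)])
      fix f assume "f \<in> F"
      with dense obtain g where g: "\<And>m. g m \<in> D" "\<And>x. x \<in> space M - Z \<Longrightarrow> (\<lambda>m. g m x) \<longlonglongrightarrow> f x"
        by blast
      then have "\<forall>i\<in>I. (\<lambda>m. g m (X i \<omega>)) \<longlonglongrightarrow> f (X i \<omega>)"
        using good by blast
      with g(1) show "\<exists>g. (\<forall>m. g m \<in> D) \<and> (\<forall>i\<in>I. (\<lambda>m. g m (X i \<omega>)) \<longlonglongrightarrow> f (X i \<omega>))"
        by blast
    next
      fix f j assume "f \<in> D" "s \<le> j"
      then show "p n s f j \<in> A n s j"
        using D(1) by (intro p_mem[OF fin]) auto
    next
      fix f m assume "f \<in> D"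
      then show "(\<Sum>j=s..<m. sqrt 2 ^ j * L2_norm M (\<lambda>y. f y - p n s f j y)) \<le> r n s"
        using p_sum[OF fin, of f n m] D(1) by (auto simp: d_def)
    next
      fix f i assume "f \<in> D" "i \<in> I"
      then show "(\<lambda>j. p n s f j (X i \<omega>)) \<longlonglongrightarrow> f (X i \<omega>)"
        using good fin by blast
    next
      fix j f g assume "s \<le> j" "f \<in> A n s (Suc j)" "g \<in> A n s j"
      then show "(\<Sum>i\<in>I. (f (X i \<omega>) - g (X i \<omega>))\<^sup>2) \<le> 4 * L\<^sup>2 * (L2_norm M (\<lambda>y. f y - g y))\<^sup>2 *
          (real (card I) + w * (2 ^ j + real (card I) * l))"
        unfolding l_def by (intro incr[OF n] I)
    qed (use s l w0 r L in \<open>auto simp: l_def\<close>)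
    have "gamma2_norm (s + 1) F (emp_norm (\<lambda>i. X i \<omega>) I) \<le> ennreal (K * enn2real (\<gamma> s))"
    proof (rule ennreal_le_epsilon)
      fix e :: real assume e: "e > 0"
      obtain m where m: "K / e < real m"
        using reals_Archimedean2 by blast
      obtain n where n: "n \<ge> m" "\<omega> \<in> G n"
        using \<omega> by (auto simp: E_def E0_def)
      have "K < e * real m"
        using m e by (simp add: field_simps)
      also have "\<dots> \<le> e * real (Suc n)"
        using n e by simp
      finally have "K * (1 / real (Suc n)) \<le> e"
        by (simp add: field_simps)
      then have "K * r n s \<le> K * enn2real (\<gamma> s) + e"
        by (simp add: r_def distrib_left)
      then have "ennreal (K * r n s) \<le> ennreal (K * enn2real (\<gamma> s) + e)"
        by (rule ennreal_leI)
      also have "\<dots> = ennreal (K * enn2real (\<gamma> s)) + ennreal e"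
        using K e by (intro ennreal_plus) auto
      finally show "gamma2_norm (s + 1) F (emp_norm (\<lambda>i. X i \<omega>) I)
          \<le> ennreal (K * enn2real (\<gamma> s)) + ennreal e"
        by (rule order_trans[OF bound[OF n(2)]])
    qed
    then show ?thesis
      by (simp add: K_def l_def)
  qed
  ultimately show ?thesis
    unfolding \<gamma>_def using E0(2) by (intro bexI[of _ E]) auto
qed

text \<open>The proof yields the order \<open>sqrt (log (2/\<delta>))\<close>; as \<open>2/\<delta>\<close> stays away from \<open>1\<close>, this is dominated by
  \<open>log (2/\<delta>)\<close>.\<close>

lemma sqrt_le_linear_log:
  assumes "0 < \<delta>" "\<delta> < (1::real)"
  shows "1344 * sqrt (4 + ln (2 / \<delta>) + 1) \<le> 5376 * ln (2 / \<delta>)"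
proof -
  define y where "y = ln (2 / \<delta>)"
  have "ln 2 \<le> y"
    using assms by (simp add: y_def field_simps)
  then have y: "y \<ge> 2 / 3"
    using ln2_ge_two_thirds by linarith
  have "2 / 3 * y \<le> y * y"
    using y by (intro mult_right_mono) auto
  with y have "4 + y + 1 \<le> 16 * (y * y)"
    by linarith
  then have "4 + y + 1 \<le> (4 * y)\<^sup>2"
    by (simp add: power2_eq_square)
  then have "sqrt (4 + y + 1) \<le> 4 * y"
    using y by (intro real_le_lsqrt) auto
  then show ?thesis
    by (simp add: y_def)
qed

theorem theorem4p3:
  "\<exists>a b :: real. 0 < a \<and> a \<le> b \<and>
    (\<forall>\<delta>::real. 0 < \<delta> \<and> \<delta> < 1 \<longrightarrow>
      (\<exists>c::real. a * ln (2 / \<delta>) \<le> c \<and> c \<le> b * ln (2 / \<delta>) \<and>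
        (\<forall>(M :: 'a measure) (F :: ('a \<Rightarrow> real) set) (L :: real) (\<alpha> :: real)
           (N :: 'w measure) (k :: nat) (X :: nat \<Rightarrow> 'w \<Rightarrow> 'a).
           prob_space M \<longrightarrow> 0 < L \<longrightarrow>
           subgaussian_class M L F \<longrightarrow> separable_class M F \<longrightarrow>
           (\<forall>f\<in>F. (\<integral>x. f x \<partial>M) = \<alpha>) \<longrightarrow>
           prob_space N \<longrightarrow>
           prob_space.indep_vars N (\<lambda>_. M) X {1..k} \<longrightarrow>
           (\<forall>i\<in>{1..k}. distr N M (X i) = M) \<longrightarrow>
           (\<exists>E\<in>sets N. measure N E \<ge> 1 - \<delta> \<and>
             (\<forall>\<omega>\<in>E. \<forall>I s. I \<subseteq> {1..k} \<longrightarrow> I \<noteq> {} \<longrightarrow>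
                2 ^ s \<le> real (card I) * ln (exp 1 * real k / real (card I)) \<longrightarrow>
                gamma2_norm (s + 1) F (emp_norm (\<lambda>i. X i \<omega>) I)
                  \<le> ennreal (c * L) * gamma2_norm s F (L2_norm M)
                      * ennreal (sqrt (ln (exp 1 * real k / real (card I)))))))))"
proof (rule exI[of _ 5376], rule exI[of _ 5376], intro conjI allI impI)
  fix \<delta> :: real assume \<delta>: "0 < \<delta> \<and> \<delta> < 1"
  define c where "c = 5376 * ln (2 / \<delta>)"
  have c: "c > 0"
    using \<delta> by (simp add: c_def)
  have main: "\<exists>E\<in>sets N. measure N E \<ge> 1 - \<delta> \<and>
             (\<forall>\<omega>\<in>E. \<forall>I s. I \<subseteq> {1..k} \<longrightarrow> I \<noteq> {} \<longrightarrow>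
                2 ^ s \<le> real (card I) * ln (exp 1 * real k / real (card I)) \<longrightarrow>
                gamma2_norm (s + 1) F (emp_norm (\<lambda>i. X i \<omega>) I)
                  \<le> ennreal (c * L) * gamma2_norm s F (L2_norm M)
                      * ennreal (sqrt (ln (exp 1 * real k / real (card I)))))"
    if asm: "0 < L" "subgaussian_class M L F" "separable_class M F" "prob_space N"
      "prob_space.indep_vars N (\<lambda>_. M) X {1..k}" "\<forall>i\<in>{1..k}. distr N M (X i) = M"
    for M :: "'a measure" and F L and N :: "'w measure" and k X
  proof -
    define l where "l I = ln (exp 1 * real k / real (card I))" for I :: "nat set"
    interpret N: prob_space N by fact
    have l: "l I \<ge> 1" if "I \<subseteq> {1..k}" "I \<noteq> {}" for I
      unfolding l_def by (rule index_set_bounds(4)[OF that])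
    have top: "ennreal (c * L) * \<top> * ennreal (sqrt (l I)) = \<top>" if "I \<subseteq> {1..k}" "I \<noteq> {}" for I
      using l[OF that] c \<open>0 < L\<close> by (simp add: ennreal_mult_top ennreal_top_mult)
    show ?thesis
    proof (cases "F = {}")
      case True
      then have no_adm: "\<not> admissible_seq F A" for A
        by (auto simp: admissible_seq_def)
      have "gamma2_norm s F (L2_norm M) = \<top>" for s
        by (simp add: gamma2_norm_def gamma2_def no_adm)
      then show ?thesis
        using \<delta> top by (intro bexI[of _ "space N"]) (auto simp: N.prob_space l_def)
    next
      case False
      obtain E where E: "E \<in> sets N" "measure N E \<ge> 1 - \<delta>" and
        bound: "\<And>\<omega> I s. \<omega> \<in> E \<Longrightarrow> I \<subseteq> {1..k} \<Longrightarrow> I \<noteq> {} \<Longrightarrow> 2 ^ s \<le> real (card I) * l I \<Longrightarrow>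
          gamma2_norm s F (L2_norm M) < \<top> \<Longrightarrow>
          gamma2_norm (s + 1) F (emp_norm (\<lambda>i. X i \<omega>) I) \<le>
            ennreal (1344 * sqrt (4 + ln (2 / \<delta>) + 1) * L * sqrt (l I) *
              enn2real (gamma2_norm s F (L2_norm M)))"
        using emp_gamma2_bound_whp[OF asm(4,1,2,3) False asm(5) _ _ _ refl, of \<delta>] asm(6) \<delta>
        unfolding l_def by auto
      have "gamma2_norm (s + 1) F (emp_norm (\<lambda>i. X i \<omega>) I)
          \<le> ennreal (c * L) * gamma2_norm s F (L2_norm M) * ennreal (sqrt (l I))"
        if *: "\<omega> \<in> E" "I \<subseteq> {1..k}" "I \<noteq> {}" "2 ^ s \<le> real (card I) * l I" for \<omega> I s
      proof (cases "gamma2_norm s F (L2_norm M) < \<top>")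
        case True
        have l0: "l I \<ge> 0"
          using l[OF *(2,3)] by simp
        have "gamma2_norm (s + 1) F (emp_norm (\<lambda>i. X i \<omega>) I) \<le>
            ennreal (1344 * sqrt (4 + ln (2 / \<delta>) + 1) * L * sqrt (l I) *
              enn2real (gamma2_norm s F (L2_norm M)))"
          by (rule bound[OF * True])
        also have "\<dots> \<le> ennreal (c * L * sqrt (l I) * enn2real (gamma2_norm s F (L2_norm M)))"
          unfolding c_def using \<delta> l0 \<open>0 < L\<close>
          by (intro ennreal_leI mult_right_mono sqrt_le_linear_log) auto
        also have "\<dots> = ennreal (c * L) * ennreal (enn2real (gamma2_norm s F (L2_norm M))) *
            ennreal (sqrt (l I))"
          using c \<open>0 < L\<close> l0 by (simp add: ennreal_mult [symmetric] mult_ac)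
        finally show ?thesis
          using True by simp
      next
        case False
        then show ?thesis
          using top[OF *(2,3)] by (simp add: not_less top_unique)
      qed
      with E show ?thesis
        unfolding l_def by (intro bexI[of _ E]) auto
    qed
  qed
  show "\<exists>c::real. 5376 * ln (2 / \<delta>) \<le> c \<and> c \<le> 5376 * ln (2 / \<delta>) \<and>
        (\<forall>(M :: 'a measure) (F :: ('a \<Rightarrow> real) set) (L :: real) (\<alpha> :: real)
           (N :: 'w measure) (k :: nat) (X :: nat \<Rightarrow> 'w \<Rightarrow> 'a).
           prob_space M \<longrightarrow> 0 < L \<longrightarrow>
           subgaussian_class M L F \<longrightarrow> separable_class M F \<longrightarrow>
           (\<forall>f\<in>F. (\<integral>x. f x \<partial>M) = \<alpha>) \<longrightarrow>
           prob_space N \<longrightarrow>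
           prob_space.indep_vars N (\<lambda>_. M) X {1..k} \<longrightarrow>
           (\<forall>i\<in>{1..k}. distr N M (X i) = M) \<longrightarrow>
           (\<exists>E\<in>sets N. measure N E \<ge> 1 - \<delta> \<and>
             (\<forall>\<omega>\<in>E. \<forall>I s. I \<subseteq> {1..k} \<longrightarrow> I \<noteq> {} \<longrightarrow>
                2 ^ s \<le> real (card I) * ln (exp 1 * real k / real (card I)) \<longrightarrow>
                gamma2_norm (s + 1) F (emp_norm (\<lambda>i. X i \<omega>) I)
                  \<le> ennreal (c * L) * gamma2_norm s F (L2_norm M)
                      * ennreal (sqrt (ln (exp 1 * real k / real (card I)))))))"
  proof (intro exI[of _ c] conjI allI impI, goal_cases)
    case (3 M F L \<alpha> N k X)
    show ?case
      by (rule main) (use 3 in simp_all)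
  qed (simp_all add: c_def)
qed auto

end
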